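(* Consider the Gaussian white noise model and the modified estimator $$\widehat f_1:=\sum_{j=-1}^{J_0}\sum_{k\in I_j}Y_{j,k}\psi_{j,k}+\sum_{j=J_0+1}^{J}\mathbf{1}(t_j>0)\sum_{k\in I_j}Y_{j,k}\psi_{j,k},$$ with $J_0$, $J$ and the data-driven levels $t_j$ defined in the context. For any $\beta,Q\in(0,\infty)$ there exist a constant $c>0$ and $n_0$ such that for all $n\ge n_0$ $$\sup_{f\in\Theta(\beta,Q)}\mathbb{E}_f\big[\|\widehat f_1-f\|_\infty\big]\ \ge\ c\,\Big(\frac n{\log n}\Big)^{-\beta/(2\beta+1)}(\log n)^{1/(4\beta+2)}.$$ Consequently, $\widehat f_1$ does not achieve the adaptive rate $(n/\log n)^{-\beta/(2\beta+1)}$ with respect to $L^\infty$-loss.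
   Context: Model: one observes $(Y_t)_{t\in[0,1]}$ with $dY_t=f(t)\,dt+n^{-1/2}dW_t$, $W$ a Brownian motion; $\mathbb{E}_f$ denotes expectation under regression function $f$. $\|\cdot\|_\infty$ is the $L^\infty$-norm on $[0,1]$. Wavelets: $(\phi,\psi)$ is a scaling and wavelet function generating an orthonormal wavelet basis $\{\psi_{j,k}: j\ge -1,\ k\in I_j\}$ of $L^2[0,1]$, where $\psi_{-1,k}=\phi(\cdot-k)$ and $\psi_{j,k}=2^{j/2}\psi(2^j\cdot-k)$ for $j\ge 0$ (near the endpoints of $[0,1]$ one uses the boundary-adapted functions of the Cohen–Daubechies–Vial construction). The basis is $s$-regular: $\phi,\psi$ have compact support and are $s$-times continuously differentiable. $I_j$ is the finite set of indices on resolution level $j$, and $|I_j|\asymp 2^j$. For $f\in L^2[0,1]$, $d_{j,k}=\int f\psi_{j,k}$. The empirical wavelet coefficients are $Y_{j,k}=\int\psi_{j,k}(u)\,dY_u=d_{j,k}+n^{-1/2}\epsilon_{j,k}$, with $(\epsilon_{j,k})$ i.i.d. standard normal. Parameter space: $\Theta(\beta,Q)=\{f=\sum_{j=-1}^\infty\sum_{k\in I_j}d_{j,k}\psi_{j,k}:\ |d_{j,k}|\le Q2^{-\frac j2(2\beta+1)}\ \text{for all } j\ge-1,\ k\in I_j\}$. Levels $t_j$: let $\mathcal{P}=\mathcal{P}_n=\{p: p=2^r,\ r=0,1,2,\ldots,\ p+1\le \log n/(\log\log n)^2\}$ ($n$ large enough that $\mathcal P\neq\emptyset$) and $K_p=(6\sqrt2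 e+1)p^{p/2}$. For a level $j$ and $p\in\mathcal{P}$ put $D_{j,p}=\{S\subset I_j:\ \sum_{k\in S}|Y_{j,k}|^p\ge 2^pK_pn^{-p/2}|I_j|\}$, $L_{j,p}=\min_{S\in D_{j,p}}|S|$ (with $L_{j,p}=\infty$ if $D_{j,p}=\emptyset$), and $t_{j,p}=\frac2{\sqrt n}\big(\frac{K_p|I_j|}{L_{j,p}-1}\big)^{1/p}$, with the conventions $1/0=+\infty$ and $1/\infty=0$. Let $u_n=1/\log\log n$, let $J_0$ be the smallest $j$ with $|I_j|>n^{u_n}$, and let $J$ be an integer (depending on $n$) with $2^J\asymp n$. For $J_0<j\le J$ set $t_j=\infty$ if $\max_{k\in I_j}|Y_{j,k}|>3\sqrt{\log n/n}$, and $t_j=\max_{p\in\mathcal{P}}t_{j,p}$ otherwise. $a_n\asymp b_n$ means $a_n/b_n$ is bounded above and below by positive constants. *)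

theory Defs
  imports "HOL-Probability.Probability" "HOL-Probability.Essential_Supremum"
begin

definition L2 :: "real measure \<Rightarrow> (real \<Rightarrow> real) set" where
  "L2 \<mu> = {g \<in> borel_measurable \<mu>. integrable \<mu> (\<lambda>x. (g x)\<^sup>2)}"

definition orthonormal_basis :: "real measure \<Rightarrow> 'i set \<Rightarrow> ('i \<Rightarrow> real \<Rightarrow> real) \<Rightarrow> bool" where
  "orthonormal_basis \<mu> B e \<longleftrightarrow>
     (\<forall>i\<in>B. e i \<in> L2 \<mu>) \<and>
     (\<forall>i\<in>B. \<forall>i'\<in>B. (\<integral>x. e i x * e i' x \<partial>\<mu>) = (if i = i' then 1 else 0)) \<and>
     (\<forall>g\<in>L2 \<mu>. (\<forall>i\<in>B. (\<integral>x. g x * e i x \<partial>\<mu>) = 0) \<longrightarrow> (AE x in \<mu>. g x = 0))"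

definition sup_norm :: "(real \<Rightarrow> real) \<Rightarrow> ennreal" where
  "sup_norm g = esssup (lebesgue_on {0..1}) (\<lambda>x. ennreal \<bar>g x\<bar>)"

definition times_cont_diff :: "nat \<Rightarrow> (real \<Rightarrow> real) \<Rightarrow> bool" where
  "times_cont_diff s g \<longleftrightarrow>
     (\<forall>i<s. (deriv ^^ i) g differentiable_on UNIV) \<and> continuous_on UNIV ((deriv ^^ s) g)"

definition compactly_supported :: "(real \<Rightarrow> real) \<Rightarrow> bool" where
  "compactly_supported g \<longleftrightarrow> (\<exists>R. \<forall>x. \<bar>x\<bar> > R \<longrightarrow> g x = 0)"

definition comparable_on :: "'i set \<Rightarrow> ('i \<Rightarrow> real) \<Rightarrow> ('i \<Rightarrow> real) \<Rightarrow> bool" where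
  "comparable_on A a b \<longleftrightarrow> (\<exists>c>0. \<exists>C>0. \<forall>i\<in>A. c * b i \<le> a i \<and> a i \<le> C * b i)"

text \<open>Resolution levels are integers \<open>j \<ge> -1\<close>; level \<open>-1\<close> carries the scaling functions.\<close>

definition wav :: "(real \<Rightarrow> real) \<Rightarrow> (real \<Rightarrow> real) \<Rightarrow> int \<Rightarrow> int \<Rightarrow> real \<Rightarrow> real" where
  "wav \<phi> \<psi> j k x =
     (if j = -1 then \<phi> (x - of_int k)
      else 2 powr (of_int j / 2) * \<psi> (2 powr of_int j * x - of_int k))"

text \<open>A compactly supported, \<open>s\<close>-regular scaling function \<open>\<phi>\<close> and wavelet \<open>\<psi>\<close> on the real
  line, coming from a multiresolution analysis (the two refinement equations have finite filters
  because of the compact supports); \<open>N\<close> is a number of vanishing moments of \<open>\<psi>\<close>.\<close>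

definition scaling_wavelet_pair ::
    "nat \<Rightarrow> nat \<Rightarrow> (real \<Rightarrow> real) \<Rightarrow> (real \<Rightarrow> real) \<Rightarrow> bool" where
  "scaling_wavelet_pair s N \<phi> \<psi> \<longleftrightarrow>
     times_cont_diff s \<phi> \<and> times_cont_diff s \<psi> \<and>
     compactly_supported \<phi> \<and> compactly_supported \<psi> \<and>
     (\<exists>F h. finite F \<and> (\<forall>x. \<phi> x = (\<Sum>m\<in>F. h m * \<phi> (2 * x - of_int m)))) \<and>
     (\<exists>F h. finite F \<and> (\<forall>x. \<psi> x = (\<Sum>m\<in>F. h m * \<phi> (2 * x - of_int m)))) \<and>
     orthonormal_basis lebesgue {(j, k). -1 \<le> j} (\<lambda>(j, k). wav \<phi> \<psi> j k) \<and>
     (\<forall>i<N. (\<integral>x. x ^ i * \<psi> x \<partial>lebesgue) = 0)"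

text \<open>Interior functions are the untouched dilates and translates whose support fits into the unit
  interval.  The functions near an endpoint are the boundary-adapted wavelets of Cohen, Daubechies
  and Vial: at each endpoint there are \<open>N\<close> fixed edge wavelets on the half-line \<open>H\<close>, which lie in
  the same multiresolution analysis restricted to \<open>H\<close> and keep \<open>N\<close> vanishing moments, and they
  enter level \<open>j\<close> through dilation about that endpoint.\<close>

definition interior_wavelet ::
    "(real \<Rightarrow> real) \<Rightarrow> (real \<Rightarrow> real) \<Rightarrow> int \<Rightarrow> int \<Rightarrow> (real \<Rightarrow> real) \<Rightarrow> bool" where
  "interior_wavelet \<phi> \<psi> j k g \<longleftrightarrow>
     (\<forall>x\<in>{0..1}. g x = wav \<phi> \<psi> j k x) \<and> (\<forall>x. x \<notin> {0..1} \<longrightarrow> wav \<phi> \<psi> j k x = 0)"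

definition edge_wavelet :: "(real \<Rightarrow> real) \<Rightarrow> nat \<Rightarrow> real set \<Rightarrow> (real \<Rightarrow> real) \<Rightarrow> bool" where
  "edge_wavelet \<phi> N H e \<longleftrightarrow>
     (\<exists>F h. finite F \<and> (\<forall>x\<in>H. e x = (\<Sum>m\<in>F. h m * \<phi> (2 * x - of_int m)))) \<and>
     (\<forall>i<N. (\<integral>x. x ^ i * e x \<partial>lebesgue_on H) = 0)"

text \<open>The Cohen-Daubechies-Vial construction only separates the two endpoints from some level
  \<open>j0\<close> on.  On the finitely many coarser levels (level \<open>-1\<close> included) a function that is not an
  interior one is some element of the approximation space of level \<open>j0\<close>.\<close>

definition wavelet_basis ::
    "nat \<Rightarrow> nat \<Rightarrow> (real \<Rightarrow> real) \<Rightarrow> (real \<Rightarrow> real) \<Rightarrow> (int \<Rightarrow> int set) \<Rightarrow>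
     (int \<Rightarrow> int \<Rightarrow> real \<Rightarrow> real) \<Rightarrow> bool" where
  "wavelet_basis s N \<phi> \<psi> I \<Psi> \<longleftrightarrow>
     scaling_wavelet_pair s N \<phi> \<psi> \<and>
     (\<forall>j\<ge>-1. finite (I j)) \<and>
     comparable_on {-1..} (\<lambda>j. real (card (I j))) (\<lambda>j. 2 powr of_int j) \<and>
     orthonormal_basis (lebesgue_on {0..1}) (Sigma {-1..} I) (\<lambda>(j, k). \<Psi> j k) \<and>
     (\<exists>j0\<ge>0. \<exists>eL eR.
        (\<forall>l<N. edge_wavelet \<phi> N {0..} (eL l) \<and> edge_wavelet \<phi> N {..0} (eR l)) \<and>
        (\<forall>j\<ge>-1. \<forall>k\<in>I j.
           interior_wavelet \<phi> \<psi> j k (\<Psi> j k) \<or>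
           (j0 \<le> j \<and> (\<exists>l<N. \<forall>x\<in>{0..1}.
              \<Psi> j k x = 2 powr (of_int j / 2) * eL l (2 powr of_int j * x))) \<or>
           (j0 \<le> j \<and> (\<exists>l<N. \<forall>x\<in>{0..1}.
              \<Psi> j k x = 2 powr (of_int j / 2) * eR l (2 powr of_int j * (x - 1)))) \<or>
           (j < j0 \<and> (\<exists>F h. finite F \<and> (\<forall>x\<in>{0..1}.
              \<Psi> j k x = (\<Sum>m\<in>F. h m * \<phi> (2 powr of_int j0 * x - of_int m)))))))"

definition wcoeff :: "(int \<Rightarrow> int \<Rightarrow> real \<Rightarrow> real) \<Rightarrow> (real \<Rightarrow> real) \<Rightarrow> int \<Rightarrow> int \<Rightarrow> real" where
  "wcoeff \<Psi> f j k = (\<integral>x. f x * \<Psi> j k x \<partial>lebesgue_on {0..1})"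

definition Theta ::
    "(int \<Rightarrow> int set) \<Rightarrow> (int \<Rightarrow> int \<Rightarrow> real \<Rightarrow> real) \<Rightarrow> real \<Rightarrow> real \<Rightarrow> (real \<Rightarrow> real) set" where
  "Theta I \<Psi> \<beta> Q = {f \<in> L2 (lebesgue_on {0..1}).
     (\<lambda>m::nat. \<integral>x. (f x - (\<Sum>j\<in>{-1..int m}. \<Sum>k\<in>I j. wcoeff \<Psi> f j k * \<Psi> j k x))\<^sup>2
        \<partial>lebesgue_on {0..1}) \<longlonglongrightarrow> 0 \<and>
     (\<forall>j\<ge>-1. \<forall>k\<in>I j. \<bar>wcoeff \<Psi> f j k\<bar> \<le> Q * 2 powr (- (of_int j / 2) * (2 * \<beta> + 1)))}"

definition brownian_motion :: "'w measure \<Rightarrow> (real \<Rightarrow> 'w \<Rightarrow> real) \<Rightarrow> bool" where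
  "brownian_motion M W \<longleftrightarrow>
     prob_space M \<and>
     (\<forall>t\<in>{0..1}. W t \<in> borel_measurable M) \<and>
     (AE \<omega> in M. W 0 \<omega> = 0) \<and>
     (AE \<omega> in M. continuous_on {0..1} (\<lambda>t. W t \<omega>)) \<and>
     (\<forall>s t. 0 \<le> s \<and> s < t \<and> t \<le> 1 \<longrightarrow>
        distributed M lborel (\<lambda>\<omega>. W t \<omega> - W s \<omega>) (\<lambda>x. ennreal (normal_density 0 (sqrt (t - s)) x))) \<and>
     (\<forall>m (\<tau> :: nat \<Rightarrow> real). mono_on {..m} \<tau> \<and> \<tau> ` {..m} \<subseteq> {0..1} \<longrightarrow>
        prob_space.indep_vars M (\<lambda>_. borel) (\<lambda>i \<omega>. W (\<tau> (Suc i)) \<omega> - W (\<tau> i) \<omega>) {..<m})"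

definition observation ::
    "(real \<Rightarrow> 'w \<Rightarrow> real) \<Rightarrow> nat \<Rightarrow> (real \<Rightarrow> real) \<Rightarrow> real \<Rightarrow> 'w \<Rightarrow> real" where
  "observation W n f t \<omega> = (\<integral>u. f u \<partial>lebesgue_on {0..t}) + W t \<omega> / sqrt (real n)"

text \<open>\<open>X\<close> is a version of the stochastic integral of the deterministic function \<open>g\<close> against the
  process \<open>Y\<close> over the unit interval, that is, the mean-square limit of the integrals of step
  functions tending to \<open>g\<close> in \<open>L\<^sup>2[0,1]\<close>.  It is determined only up to null sets.\<close>

definition is_stochastic_integral ::
    "'w measure \<Rightarrow> (real \<Rightarrow> 'w \<Rightarrow> real) \<Rightarrow> (real \<Rightarrow> real) \<Rightarrow> ('w \<Rightarrow> real) \<Rightarrow> bool" where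
  "is_stochastic_integral M Y g X \<longleftrightarrow>
     X \<in> borel_measurable M \<and>
     (\<exists>(m :: nat \<Rightarrow> nat) (\<tau> :: nat \<Rightarrow> nat \<Rightarrow> real) (a :: nat \<Rightarrow> nat \<Rightarrow> real).
        (\<forall>r. mono_on {..m r} (\<tau> r) \<and> \<tau> r ` {..m r} \<subseteq> {0..1}) \<and>
        (\<lambda>r. \<integral>\<^sup>+x. ennreal ((g x - (\<Sum>i<m r. a r i * indicator {\<tau> r i<..\<tau> r (Suc i)} x))\<^sup>2)
           \<partial>lebesgue_on {0..1}) \<longlonglongrightarrow> 0 \<and>
        (\<lambda>r. \<integral>\<^sup>+\<omega>. ennreal ((X \<omega> - (\<Sum>i<m r. a r i * (Y (\<tau> r (Suc i)) \<omega> - Y (\<tau> r i) \<omega>)))\<^sup>2)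
           \<partial>M) \<longlonglongrightarrow> 0)"

text \<open>Below, \<open>y j k\<close> stands for the observed empirical wavelet coefficients.\<close>

definition Pset :: "nat \<Rightarrow> nat set" where
  "Pset n = {p. (\<exists>r. p = 2 ^ r) \<and> real p + 1 \<le> ln (real n) / (ln (ln (real n)))\<^sup>2}"

definition Kconst :: "nat \<Rightarrow> real" where
  "Kconst p = (6 * sqrt 2 * exp 1 + 1) * real p powr (real p / 2)"

definition Dset :: "(int \<Rightarrow> int set) \<Rightarrow> nat \<Rightarrow> (int \<Rightarrow> int \<Rightarrow> real) \<Rightarrow> int \<Rightarrow> nat \<Rightarrow> int set set" where
  "Dset I n y j p = {S. S \<subseteq> I j \<and>
     (\<Sum>k\<in>S. \<bar>y j k\<bar> ^ p) \<ge> 2 ^ p * Kconst p * real n powr (- real p / 2) * real (card (I j))}"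

definition Lmin :: "(int \<Rightarrow> int set) \<Rightarrow> nat \<Rightarrow> (int \<Rightarrow> int \<Rightarrow> real) \<Rightarrow> int \<Rightarrow> nat \<Rightarrow> nat" where
  "Lmin I n y j p = Min (card ` Dset I n y j p)"

text \<open>The conventions \<open>1/\<infinity> = 0\<close> (no admissible set) and \<open>1/0 = \<infinity>\<close> (a singleton suffices) are
  spelled out as the first two cases.\<close>

definition tlevel_p :: "(int \<Rightarrow> int set) \<Rightarrow> nat \<Rightarrow> (int \<Rightarrow> int \<Rightarrow> real) \<Rightarrow> int \<Rightarrow> nat \<Rightarrow> ereal" where
  "tlevel_p I n y j p =
     (if Dset I n y j p = {} then 0
      else if Lmin I n y j p = 1 then \<infinity>
      else ereal (2 / sqrt (real n) *
        (Kconst p * real (card (I j)) / (real (Lmin I n y j p) - 1)) powr (1 / real p)))"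

definition tlevel :: "(int \<Rightarrow> int set) \<Rightarrow> nat \<Rightarrow> (int \<Rightarrow> int \<Rightarrow> real) \<Rightarrow> int \<Rightarrow> ereal" where
  "tlevel I n y j =
     (if Max ((\<lambda>k. \<bar>y j k\<bar>) ` I j) > 3 * sqrt (ln (real n) / real n) then \<infinity>
      else Max (tlevel_p I n y j ` Pset n))"

definition J0 :: "(int \<Rightarrow> int set) \<Rightarrow> nat \<Rightarrow> int" where
  "J0 I n = (LEAST j. -1 \<le> j \<and> real (card (I j)) > real n powr (1 / ln (ln (real n))))"

definition fhat1 ::
    "(int \<Rightarrow> int set) \<Rightarrow> (int \<Rightarrow> int \<Rightarrow> real \<Rightarrow> real) \<Rightarrow> (nat \<Rightarrow> int) \<Rightarrow> nat \<Rightarrow>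
     (int \<Rightarrow> int \<Rightarrow> real) \<Rightarrow> real \<Rightarrow> real" where
  "fhat1 I \<Psi> J n y x =
     (\<Sum>j\<in>{-1..J0 I n}. \<Sum>k\<in>I j. y j k * \<Psi> j k x) +
     (\<Sum>j\<in>{J0 I n + 1..J n}. of_bool (tlevel I n y j > 0) * (\<Sum>k\<in>I j. y j k * \<Psi> j k x))"

definition risk ::
    "'w measure \<Rightarrow> (int \<Rightarrow> int set) \<Rightarrow> (int \<Rightarrow> int \<Rightarrow> real \<Rightarrow> real) \<Rightarrow> (nat \<Rightarrow> int) \<Rightarrow>
     (nat \<Rightarrow> (real \<Rightarrow> real) \<Rightarrow> int \<Rightarrow> int \<Rightarrow> 'w \<Rightarrow> real) \<Rightarrow> nat \<Rightarrow> (real \<Rightarrow> real) \<Rightarrow> ennreal" where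
  "risk M I \<Psi> J Y n f =
     (\<integral>\<^sup>+\<omega>. sup_norm (\<lambda>x. fhat1 I \<Psi> J n (\<lambda>j k. Y n f j k \<omega>) x - f x) \<partial>M)"

end

theory Submission
  imports Defs "HOL-Real_Asymp.Real_Asymp"
begin

text \<open>Take all coefficients of \<open>f\<close> on one level \<open>j\<close> equal to a large constant times \<open>1 / sqrt n\<close>; this is
  compatible with \<open>\<Theta>(\<beta>, Q)\<close> up to \<open>2 ^ j \<asymp> n powr (1 / (2 * \<beta> + 1))\<close>, which exceeds the optimal
  resolution by a power of \<open>log n\<close>.  Already the exponent \<open>p = 1\<close> detects the level, so with probability
  bounded away from \<open>0\<close> the estimator keeps it, and it then carries noise of sup-norm at least of order
  \<open>2 powr (j / 2) * sqrt (log n / n)\<close>: a wavelet of level \<open>j\<close> has \<open>L\<^sup>1\<close>-norm \<open>O(2 powr (- j / 2))\<close>,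
  so the loss dominates \<open>2 powr (j / 2)\<close> times the largest coefficient error.  The lower bound for the
  maximum of the noise needs no independence of the coefficients: Chebyshev's inequality for
  \<open>\<Sum>k. exp (\<lambda> \<epsilon>\<^sub>k)\<close> with \<open>\<lambda>\<^sup>2 = log |I\<^sub>j| / 2\<close> only involves the laws of \<open>\<epsilon>\<^sub>k\<close> and \<open>\<epsilon>\<^sub>k + \<epsilon>\<^sub>l\<close>.\<close>

subsection \<open>Convergence in \<open>L\<^sup>2\<close>\<close>

text \<open>The weak point is that \<open>fhat1\<close> keeps or kills whole levels. Killing
  coefficients of size 1 / sqrt n costs a bias of order 2^(j/2) / sqrt n, while keeping the level
  costs 2^(j/2) sqrt(log n / n). At 2^j of order n^(1 / (2 \<beta> + 1)) the latter is the adaptive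
  rate times (log n)^(1 / (4 \<beta> + 2)): log |I_j| is still of order log n there, so the maximum
  of the noise attains the full factor sqrt(log n) up to a constant.

  The obstacle is the joint law of the noise. Each coefficient is given only as some version of a
  stochastic integral, with approximating step functions of its own. Linearity is therefore proved
  for versions, by merging two partitions, and this is the source of the law of a sum of two
  coefficients. Laws are identified by characteristic functions, because these pass to mean-square
  limits; exponential moments, which do not pass to such limits directly, are read off
  afterwards.\<close>

lemma L2_measurable: "g \<in> L2 \<mu> \<Longrightarrow> g \<in> borel_measurable \<mu>"
  and L2_integrable_square: "g \<in> L2 \<mu> \<Longrightarrow> integrable \<mu> (\<lambda>x. (g x)\<^sup>2)"
  by (auto simp: L2_def)

lemma L2_mult_integrable:
  assumes "f \<in> L2 \<mu>" "g \<in> L2 \<mu>"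
  shows "integrable \<mu> (\<lambda>x. f x * g x)"
proof (rule Bochner_Integration.integrable_bound)
  show "integrable \<mu> (\<lambda>x. (f x)\<^sup>2 + (g x)\<^sup>2)"
    using assms by (simp add: L2_def)
  show "(\<lambda>x. f x * g x) \<in> borel_measurable \<mu>"
    using assms by (auto simp: L2_def)
  have "\<bar>a * b\<bar> \<le> a\<^sup>2 + b\<^sup>2" for a b :: real
    using sum_squares_bound[of "\<bar>a\<bar>" "\<bar>b\<bar>"] mult_nonneg_nonneg[of "\<bar>a\<bar>" "\<bar>b\<bar>"]
    unfolding abs_mult power2_abs by linarith
  then show "AE x in \<mu>. norm (f x * g x) \<le> norm ((f x)\<^sup>2 + (g x)\<^sup>2)"
    by simp
qed

lemma L2_add:
  assumes "f \<in> L2 \<mu>" "g \<in> L2 \<mu>"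
  shows "(\<lambda>x. f x + g x) \<in> L2 \<mu>"
  using assms L2_mult_integrable[OF assms]
  by (auto simp: L2_def power2_sum mult.assoc)

lemma L2_cmult: "f \<in> L2 \<mu> \<Longrightarrow> (\<lambda>x. c * f x) \<in> L2 \<mu>"
  by (auto simp: L2_def power_mult_distrib)

lemma L2_diff:
  assumes "f \<in> L2 \<mu>" "g \<in> L2 \<mu>"
  shows "(\<lambda>x. f x - g x) \<in> L2 \<mu>"
  using L2_add[OF assms(1) L2_cmult[OF assms(2), of "-1"]] by simp

lemma L2_sum: "(\<And>i. i \<in> A \<Longrightarrow> f i \<in> L2 \<mu>) \<Longrightarrow> (\<lambda>x. \<Sum>i\<in>A. f i x) \<in> L2 \<mu>"
proof (induction A rule: infinite_finite_induct)
  case (insert a A)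
  then show ?case by (simp add: L2_add)
qed (auto simp: L2_def)

text \<open>The absolute value stands inside the integral because the inequality also serves to
  bound an L1-norm in \<open>integral_abs_le_of_support\<close>.\<close>

lemma L2_Cauchy_Schwarz:
  assumes "f \<in> L2 \<mu>" "g \<in> L2 \<mu>"
  shows "(\<integral>x. \<bar>f x * g x\<bar> \<partial>\<mu>)\<^sup>2 \<le> (\<integral>x. (f x)\<^sup>2 \<partial>\<mu>) * (\<integral>x. (g x)\<^sup>2 \<partial>\<mu>)"
proof -
  note [measurable] = assms[THEN L2_measurable]
  have fg: "integrable \<mu> (\<lambda>x. \<bar>f x * g x\<bar>)"
    using L2_mult_integrable[OF assms] by simp
  have "ennreal ((\<integral>x. \<bar>f x * g x\<bar> \<partial>\<mu>)\<^sup>2) = (\<integral>\<^sup>+x. ennreal \<bar>f x\<bar> * ennreal \<bar>g x\<bar> \<partial>\<mu>)\<^sup>2"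
    using nn_integral_eq_integral[OF fg] by (simp add: abs_mult ennreal_mult ennreal_power[symmetric])
  also have "\<dots> \<le> (\<integral>\<^sup>+x. (ennreal \<bar>f x\<bar>)\<^sup>2 \<partial>\<mu>) * (\<integral>\<^sup>+x. (ennreal \<bar>g x\<bar>)\<^sup>2 \<partial>\<mu>)"
    by (rule Cauchy_Schwarz_nn_integral) auto
  also have "\<dots> = ennreal ((\<integral>x. (f x)\<^sup>2 \<partial>\<mu>) * (\<integral>x. (g x)\<^sup>2 \<partial>\<mu>))"
    using assms[THEN L2_integrable_square]
    by (simp add: ennreal_power nn_integral_eq_integral ennreal_mult)
  finally show ?thesis
    by (simp add: ennreal_le_iff integral_nonneg_AE)
qed

text \<open>With \<open>f\<close> the regression function this is the convergence of the drift of
  the approximating sums.\<close>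

lemma L2_tendsto_inner:
  assumes f: "f \<in> L2 \<mu>" and h: "h \<in> L2 \<mu>" and g: "\<And>r. g r \<in> L2 \<mu>"
    and lim: "(\<lambda>r. \<integral>x. (h x - g r x)\<^sup>2 \<partial>\<mu>) \<longlonglongrightarrow> 0"
  shows "(\<lambda>r. \<integral>x. f x * g r x \<partial>\<mu>) \<longlonglongrightarrow> (\<integral>x. f x * h x \<partial>\<mu>)"
proof -
  have "(\<lambda>r. sqrt ((\<integral>x. (f x)\<^sup>2 \<partial>\<mu>) * (\<integral>x. (h x - g r x)\<^sup>2 \<partial>\<mu>)))
      \<longlonglongrightarrow> sqrt ((\<integral>x. (f x)\<^sup>2 \<partial>\<mu>) * 0)"
    by (intro tendsto_intros lim)
  then have lim0: "(\<lambda>r. sqrt ((\<integral>x. (f x)\<^sup>2 \<partial>\<mu>) * (\<integral>x. (h x - g r x)\<^sup>2 \<partial>\<mu>))) \<longlonglongrightarrow> 0"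
    by simp
  have "(\<lambda>r. (\<integral>x. f x * g r x \<partial>\<mu>) - (\<integral>x. f x * h x \<partial>\<mu>)) \<longlonglongrightarrow> 0"
  proof (rule Lim_null_comparison[OF _ lim0], rule eventuallyI)
    fix r
    have "\<bar>(\<integral>x. f x * g r x \<partial>\<mu>) - (\<integral>x. f x * h x \<partial>\<mu>)\<bar> = \<bar>\<integral>x. f x * (h x - g r x) \<partial>\<mu>\<bar>"
      using L2_mult_integrable[OF f h] L2_mult_integrable[OF f g] by (simp add: right_diff_distrib)
    also have "\<dots> \<le> (\<integral>x. \<bar>f x * (h x - g r x)\<bar> \<partial>\<mu>)"
      by (rule integral_abs_bound)
    also have "\<dots> \<le> sqrt ((\<integral>x. (f x)\<^sup>2 \<partial>\<mu>) * (\<integral>x. (h x - g r x)\<^sup>2 \<partial>\<mu>))"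
      by (rule real_le_rsqrt[OF L2_Cauchy_Schwarz[OF f L2_diff[OF h g]]])
    finally show "norm ((\<integral>x. f x * g r x \<partial>\<mu>) - (\<integral>x. f x * h x \<partial>\<mu>))
        \<le> sqrt ((\<integral>x. (f x)\<^sup>2 \<partial>\<mu>) * (\<integral>x. (h x - g r x)\<^sup>2 \<partial>\<mu>))"
      by simp
  qed
  then show ?thesis by (rule LIM_zero_cancel)
qed

text \<open>Expanding around \<open>h\<close> leaves only the inner product with a fixed function.
  This is how the variances of the approximating step integrals are shown to converge.\<close>

lemma L2_tendsto_square:
  assumes h: "h \<in> L2 \<mu>" and g: "\<And>r. g r \<in> L2 \<mu>"
    and lim: "(\<lambda>r. \<integral>x. (h x - g r x)\<^sup>2 \<partial>\<mu>) \<longlonglongrightarrow> 0"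
  shows "(\<lambda>r. \<integral>x. (g r x)\<^sup>2 \<partial>\<mu>) \<longlonglongrightarrow> (\<integral>x. (h x)\<^sup>2 \<partial>\<mu>)"
proof -
  have "(\<integral>x. (g r x)\<^sup>2 \<partial>\<mu>) = (\<integral>x. (h x - g r x)\<^sup>2 \<partial>\<mu>) + 2 * (\<integral>x. h x * g r x \<partial>\<mu>) - (\<integral>x. (h x)\<^sup>2 \<partial>\<mu>)" for r
    using L2_mult_integrable[OF h g] L2_integrable_square[OF h] L2_integrable_square[OF g]
      by (simp add: power2_diff mult.assoc)
  moreover have "(\<lambda>r. (\<integral>x. (h x - g r x)\<^sup>2 \<partial>\<mu>) + 2 * (\<integral>x. h x * g r x \<partial>\<mu>) - (\<integral>x. (h x)\<^sup>2 \<partial>\<mu>))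
      \<longlonglongrightarrow> 0 + 2 * (\<integral>x. h x * h x \<partial>\<mu>) - (\<integral>x. (h x)\<^sup>2 \<partial>\<mu>)"
    by (intro tendsto_intros lim L2_tendsto_inner h g)
  ultimately show ?thesis
    by (simp add: power2_eq_square)
qed

subsection \<open>Step functions and stochastic integrals\<close>

text \<open>Telescoping. A cell of the grid lies in the half-open interval exactly when its right
  endpoint does, which is why the indicator is evaluated at \<open>\<sigma> (Suc l)\<close>; the
  left endpoint would be off by one cell.\<close>

lemma increment_refine:
  fixes \<sigma> :: "nat \<Rightarrow> real"
  assumes \<sigma>: "strict_mono_on {..q} \<sigma>" and ab: "a \<le> b" "b \<le> q"
  shows "w (\<sigma> b) - w (\<sigma> a) =
    (\<Sum>l<q. indicator {\<sigma> a<..\<sigma> b} (\<sigma> (Suc l)) * (w (\<sigma> (Suc l)) - w (\<sigma> l) :: real))"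
proof -
  have less: "\<sigma> i < \<sigma> l \<longleftrightarrow> i < l" if "i \<le> q" "l \<le> q" for i l
    using strict_mono_on_less[OF \<sigma>, of i l] that by auto
  have le: "\<sigma> i \<le> \<sigma> l \<longleftrightarrow> i \<le> l" if "i \<le> q" "l \<le> q" for i l
    using less[OF that(2) that(1)] by (simp add: linorder_not_less[symmetric])
  have "w (\<sigma> b) - w (\<sigma> a) = (\<Sum>l\<in>{a..<b}. w (\<sigma> (Suc l)) - w (\<sigma> l))"
    using sum_Suc_diff'[OF ab(1), of "\<lambda>l. w (\<sigma> l)"] by simp
  also have "\<dots> = (\<Sum>l<q. indicator {\<sigma> a<..\<sigma> b} (\<sigma> (Suc l)) * (w (\<sigma> (Suc l)) - w (\<sigma> l)))"
    using ab by (intro sum.mono_neutral_cong_left) (auto simp: indicator_def less le split: if_splits)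
  finally show ?thesis .
qed

text \<open>The weight of a fine cell is the value of the step function at the right endpoint of
  that cell, so the new weights do not depend on \<open>w\<close>. One choice of weights hence works
  for all paths of the observed process at once.\<close>

lemma step_integral_refine:
  fixes \<sigma> \<tau> :: "nat \<Rightarrow> real" and w :: "real \<Rightarrow> real"
  assumes \<sigma>: "strict_mono_on {..q} \<sigma>" and \<tau>: "mono_on {..m} \<tau>" and sub: "\<tau> ` {..m} \<subseteq> \<sigma> ` {..q}"
  shows "(\<Sum>i<m. a i * (w (\<tau> (Suc i)) - w (\<tau> i))) =
    (\<Sum>l<q. (\<Sum>i<m. a i * indicator {\<tau> i<..\<tau> (Suc i)} (\<sigma> (Suc l))) * (w (\<sigma> (Suc l)) - w (\<sigma> l)))"
proof -
  have "a i * (w (\<tau> (Suc i)) - w (\<tau> i)) =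
      (\<Sum>l<q. a i * indicator {\<tau> i<..\<tau> (Suc i)} (\<sigma> (Suc l)) * (w (\<sigma> (Suc l)) - w (\<sigma> l)))" if "i < m" for i
  proof -
    have "\<tau> i \<in> \<sigma> ` {..q}" "\<tau> (Suc i) \<in> \<sigma> ` {..q}"
      using sub \<open>i < m\<close> by auto
    then obtain u v where uv: "u \<le> q" "v \<le> q" "\<tau> i = \<sigma> u" "\<tau> (Suc i) = \<sigma> v"
      by auto
    have "\<sigma> u \<le> \<sigma> v"
      using monotone_onD[OF \<tau>, of i "Suc i"] that uv by simp
    then have "u \<le> v"
      using strict_mono_on_less[OF \<sigma>, of v u] uv by (meson atMost_iff linorder_not_le)
    then show ?thesis
      unfolding uv increment_refine[OF \<sigma> \<open>u \<le> v\<close> \<open>v \<le> q\<close>, of w] by (simp only: sum_distrib_left mult.assoc)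
  qed
  then have "(\<Sum>i<m. a i * (w (\<tau> (Suc i)) - w (\<tau> i))) =
      (\<Sum>i<m. \<Sum>l<q. a i * indicator {\<tau> i<..\<tau> (Suc i)} (\<sigma> (Suc l)) * (w (\<sigma> (Suc l)) - w (\<sigma> l)))"
    by (intro sum.cong) auto
  also have "\<dots> = (\<Sum>l<q. \<Sum>i<m. a i * indicator {\<tau> i<..\<tau> (Suc i)} (\<sigma> (Suc l)) * (w (\<sigma> (Suc l)) - w (\<sigma> l)))"
    by (rule sum.swap)
  finally show ?thesis
    by (simp only: sum_distrib_right)
qed

text \<open>The step function itself is the step integral of \<open>t \<mapsto> 1(x \<le> t)\<close>.\<close>

lemma step_function_refine:
  fixes \<sigma> \<tau> :: "nat \<Rightarrow> real"
  assumes \<sigma>: "strict_mono_on {..q} \<sigma>" and \<tau>: "mono_on {..m} \<tau>" and sub: "\<tau> ` {..m} \<subseteq> \<sigma> ` {..q}"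
  shows "(\<Sum>i<m. a i * indicator {\<tau> i<..\<tau> (Suc i)} x) =
    (\<Sum>l<q. (\<Sum>i<m. a i * indicator {\<tau> i<..\<tau> (Suc i)} (\<sigma> (Suc l))) * indicator {\<sigma> l<..\<sigma> (Suc l)} x :: real)"
proof -
  have ind: "indicator {u<..v} x = (of_bool (x \<le> v) - of_bool (x \<le> u) :: real)" if "u \<le> v" for u v :: real
    using that by (auto simp: indicator_def)
  have "\<tau> i \<le> \<tau> (Suc i)" if "i < m" for i
    using monotone_onD[OF \<tau>, of i "Suc i"] that by simp
  moreover have "\<sigma> l \<le> \<sigma> (Suc l)" if "l < q" for l
    using monotone_onD[OF \<sigma>, of l "Suc l"] that by simp
  ultimately show ?thesis
    using step_integral_refine[OF assms, of a "\<lambda>t. of_bool (x \<le> t)"] by (simp add: ind)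
qed

text \<open>The merged grid is the sorted list of all nodes. Passing to a set removes repeated
  nodes, which makes \<sigma> strictly increasing and lets the order of the nodes be read off from
  their indices.\<close>

lemma common_refinement:
  fixes \<tau> \<tau>' :: "nat \<Rightarrow> real" and B :: "real set"
  assumes "mono_on {..m} \<tau>" "\<tau> ` {..m} \<subseteq> B" "mono_on {..m'} \<tau>'" "\<tau>' ` {..m'} \<subseteq> B"
  obtains q \<sigma> b where "mono_on {..q} \<sigma>" "\<sigma> ` {..q} \<subseteq> B"
    "\<And>x. (\<Sum>l<q. b l * indicator {\<sigma> l<..\<sigma> (Suc l)} x :: real) =
       (\<Sum>i<m. a i * indicator {\<tau> i<..\<tau> (Suc i)} x) + (\<Sum>i<m'. a' i * indicator {\<tau>' i<..\<tau>' (Suc i)} x)"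
    "\<And>w :: real \<Rightarrow> real. (\<Sum>l<q. b l * (w (\<sigma> (Suc l)) - w (\<sigma> l))) =
       (\<Sum>i<m. a i * (w (\<tau> (Suc i)) - w (\<tau> i))) + (\<Sum>i<m'. a' i * (w (\<tau>' (Suc i)) - w (\<tau>' i)))"
proof -
  define T where "T = \<tau> ` {..m} \<union> \<tau>' ` {..m'}"
  have T: "finite T" "T \<noteq> {}" "T \<subseteq> B"
    using assms by (auto simp: T_def)
  \<comment> \<open>The nodes are numbered from 0 to \<open>q\<close>, so there is one cell fewer
    than there are nodes.\<close>
  define q where "q = card T - 1"
  define \<sigma> where "\<sigma> = (\<lambda>l. sorted_list_of_set T ! l)"
  have len: "length (sorted_list_of_set T) = Suc q"
    using T by (simp add: q_def card_gt_0_iff)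
  have \<sigma>: "strict_mono_on {..q} \<sigma>"
    unfolding \<sigma>_def using len sorted_wrt_nth_less[OF strict_sorted_list_of_set[of T]]
    by (intro strict_mono_onI) auto
  have "\<sigma> ` {..q} = set (sorted_list_of_set T)"
    unfolding \<sigma>_def set_conv_nth using len by (auto simp: less_Suc_eq_le)
  then have img: "\<sigma> ` {..q} = T"
    using T by simp
  then have sub: "\<tau> ` {..m} \<subseteq> \<sigma> ` {..q}" "\<tau>' ` {..m'} \<subseteq> \<sigma> ` {..q}"
    by (auto simp: T_def)
  show thesis
  proof (rule that[of q \<sigma> "\<lambda>l. (\<Sum>i<m. a i * indicator {\<tau> i<..\<tau> (Suc i)} (\<sigma> (Suc l))) +
      (\<Sum>i<m'. a' i * indicator {\<tau>' i<..\<tau>' (Suc i)} (\<sigma> (Suc l)))"])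
    show "mono_on {..q} \<sigma>"
      using \<sigma> by (rule strict_mono_on_imp_mono_on)
    show "\<sigma> ` {..q} \<subseteq> B"
      using img T by simp
  qed (simp_all only: distrib_right sum.distrib
      step_function_refine[OF \<sigma> assms(1) sub(1), symmetric] step_function_refine[OF \<sigma> assms(3) sub(2), symmetric]
      step_integral_refine[OF \<sigma> assms(1) sub(1), symmetric] step_integral_refine[OF \<sigma> assms(3) sub(2), symmetric])
qed

section \<open>Additivity of the stochastic integral\<close>

lemma nn_integral_square_add_tendsto_0:
  fixes u v :: "nat \<Rightarrow> 'a \<Rightarrow> real"
  assumes u: "(\<lambda>r. \<integral>\<^sup>+x. ennreal ((u r x)\<^sup>2) \<partial>\<mu>) \<longlonglongrightarrow> 0" "\<And>r. u r \<in> borel_measurable \<mu>"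
    and v: "(\<lambda>r. \<integral>\<^sup>+x. ennreal ((v r x)\<^sup>2) \<partial>\<mu>) \<longlonglongrightarrow> 0" "\<And>r. v r \<in> borel_measurable \<mu>"
  shows "(\<lambda>r. \<integral>\<^sup>+x. ennreal ((u r x + v r x)\<^sup>2) \<partial>\<mu>) \<longlonglongrightarrow> 0"
proof -
  note [measurable] = u(2) v(2)
  have "(\<lambda>r. 2 * (\<integral>\<^sup>+x. ennreal ((u r x)\<^sup>2) \<partial>\<mu>) + 2 * (\<integral>\<^sup>+x. ennreal ((v r x)\<^sup>2) \<partial>\<mu>)) \<longlonglongrightarrow> 2 * 0 + 2 * 0"
    by (intro tendsto_add ennreal_tendsto_cmult u v) auto
  then have "(\<lambda>r. 2 * (\<integral>\<^sup>+x. ennreal ((u r x)\<^sup>2) \<partial>\<mu>) + 2 * (\<integral>\<^sup>+x. ennreal ((v r x)\<^sup>2) \<partial>\<mu>)) \<longlonglongrightarrow> 0"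
    by simp
  then show ?thesis
  proof (rule tendsto_sandwich[rotated 3])
    have le: "(a + b)\<^sup>2 \<le> 2 * a\<^sup>2 + 2 * b\<^sup>2" for a b :: real
      using sum_squares_bound[of a b] by (simp add: power2_sum)
    have "(\<integral>\<^sup>+x. ennreal ((u r x + v r x)\<^sup>2) \<partial>\<mu>)
        \<le> (\<integral>\<^sup>+x. 2 * ennreal ((u r x)\<^sup>2) + 2 * ennreal ((v r x)\<^sup>2) \<partial>\<mu>)" for r
    proof (rule nn_integral_mono)
      fix x
      have "ennreal ((u r x + v r x)\<^sup>2) \<le> ennreal (2 * (u r x)\<^sup>2 + 2 * (v r x)\<^sup>2)"
        by (rule ennreal_leI[OF le])
      then show "ennreal ((u r x + v r x)\<^sup>2) \<le> 2 * ennreal ((u r x)\<^sup>2) + 2 * ennreal ((v r x)\<^sup>2)"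
        by (simp add: ennreal_plus ennreal_mult)
    qed
    also have "(\<integral>\<^sup>+x. 2 * ennreal ((u r x)\<^sup>2) + 2 * ennreal ((v r x)\<^sup>2) \<partial>\<mu>) =
        2 * (\<integral>\<^sup>+x. ennreal ((u r x)\<^sup>2) \<partial>\<mu>) + 2 * (\<integral>\<^sup>+x. ennreal ((v r x)\<^sup>2) \<partial>\<mu>)" for r
      by (simp add: nn_integral_add nn_integral_cmult)
    finally show "\<forall>\<^sub>F r in sequentially. (\<integral>\<^sup>+x. ennreal ((u r x + v r x)\<^sup>2) \<partial>\<mu>)
        \<le> 2 * (\<integral>\<^sup>+x. ennreal ((u r x)\<^sup>2) \<partial>\<mu>) + 2 * (\<integral>\<^sup>+x. ennreal ((v r x)\<^sup>2) \<partial>\<mu>)"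
      by simp
  qed auto
qed

text \<open>The two versions come with unrelated partitions, so their sums can be added only over a
  common refinement. All information about the joint behaviour of two coefficients comes from
  here.\<close>

lemma is_stochastic_integral_add:
  assumes "is_stochastic_integral M Y g X" "is_stochastic_integral M Y g' X'"
    and Y: "\<And>t. t \<in> {0..1} \<Longrightarrow> Y t \<in> borel_measurable M"
    and g: "g \<in> borel_measurable (lebesgue_on {0..1})" "g' \<in> borel_measurable (lebesgue_on {0..1})"
  shows "is_stochastic_integral M Y (\<lambda>x. g x + g' x) (\<lambda>\<omega>. X \<omega> + X' \<omega>)"
proof -
  let ?\<mu> = "lebesgue_on {0..1::real}"
  obtain m :: "nat \<Rightarrow> nat" and \<tau> a :: "nat \<Rightarrow> nat \<Rightarrow> real" where 1: "\<And>r. mono_on {..m r} (\<tau> r)" "\<And>r. \<tau> r ` {..m r} \<subseteq> {0..1}"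
      "(\<lambda>r. \<integral>\<^sup>+x. ennreal ((g x - (\<Sum>i<m r. a r i * indicator {\<tau> r i<..\<tau> r (Suc i)} x))\<^sup>2) \<partial>?\<mu>) \<longlonglongrightarrow> 0"
      "(\<lambda>r. \<integral>\<^sup>+\<omega>. ennreal ((X \<omega> - (\<Sum>i<m r. a r i * (Y (\<tau> r (Suc i)) \<omega> - Y (\<tau> r i) \<omega>)))\<^sup>2) \<partial>M) \<longlonglongrightarrow> 0"
      "X \<in> borel_measurable M"
    using assms(1) unfolding is_stochastic_integral_def by blast
  obtain m' :: "nat \<Rightarrow> nat" and \<tau>' a' :: "nat \<Rightarrow> nat \<Rightarrow> real" where 2: "\<And>r. mono_on {..m' r} (\<tau>' r)" "\<And>r. \<tau>' r ` {..m' r} \<subseteq> {0..1}"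
      "(\<lambda>r. \<integral>\<^sup>+x. ennreal ((g' x - (\<Sum>i<m' r. a' r i * indicator {\<tau>' r i<..\<tau>' r (Suc i)} x))\<^sup>2) \<partial>?\<mu>) \<longlonglongrightarrow> 0"
      "(\<lambda>r. \<integral>\<^sup>+\<omega>. ennreal ((X' \<omega> - (\<Sum>i<m' r. a' r i * (Y (\<tau>' r (Suc i)) \<omega> - Y (\<tau>' r i) \<omega>)))\<^sup>2) \<partial>M) \<longlonglongrightarrow> 0"
      "X' \<in> borel_measurable M"
    using assms(2) unfolding is_stochastic_integral_def by blast
  have "\<exists>q \<sigma> b. mono_on {..q} \<sigma> \<and> \<sigma> ` {..q} \<subseteq> {0..1} \<and>
      (\<forall>x. (\<Sum>l<q. b l * indicator {\<sigma> l<..\<sigma> (Suc l)} x :: real) =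
         (\<Sum>i<m r. a r i * indicator {\<tau> r i<..\<tau> r (Suc i)} x) + (\<Sum>i<m' r. a' r i * indicator {\<tau>' r i<..\<tau>' r (Suc i)} x)) \<and>
      (\<forall>w :: real \<Rightarrow> real. (\<Sum>l<q. b l * (w (\<sigma> (Suc l)) - w (\<sigma> l))) =
         (\<Sum>i<m r. a r i * (w (\<tau> r (Suc i)) - w (\<tau> r i))) + (\<Sum>i<m' r. a' r i * (w (\<tau>' r (Suc i)) - w (\<tau>' r i))))" for r
    by (rule common_refinement[OF 1(1,2)[of r] 2(1,2)[of r], where a = "a r" and a' = "a' r"]) blast
  then obtain q :: "nat \<Rightarrow> nat" and \<sigma> b :: "nat \<Rightarrow> nat \<Rightarrow> real" where 3: "\<And>r. mono_on {..q r} (\<sigma> r)" "\<And>r. \<sigma> r ` {..q r} \<subseteq> {0..1}"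
      "\<And>r x. (\<Sum>l<q r. b r l * indicator {\<sigma> r l<..\<sigma> r (Suc l)} x :: real) =
         (\<Sum>i<m r. a r i * indicator {\<tau> r i<..\<tau> r (Suc i)} x) + (\<Sum>i<m' r. a' r i * indicator {\<tau>' r i<..\<tau>' r (Suc i)} x)"
      "\<And>r w :: real \<Rightarrow> real. (\<Sum>l<q r. b r l * (w (\<sigma> r (Suc l)) - w (\<sigma> r l))) =
         (\<Sum>i<m r. a r i * (w (\<tau> r (Suc i)) - w (\<tau> r i))) + (\<Sum>i<m' r. a' r i * (w (\<tau>' r (Suc i)) - w (\<tau>' r i)))"
    by metis
  have [measurable]: "Y (\<tau> r i) \<in> borel_measurable M" if "i \<le> m r" for r i
    using 1(2) that by (intro Y) (auto simp: image_subset_iff)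
  have [measurable]: "Y (\<tau>' r i) \<in> borel_measurable M" if "i \<le> m' r" for r i
    using 2(2) that by (intro Y) (auto simp: image_subset_iff)
  note [measurable] = g 1(5) 2(5)
  have id: "(u + v) - (p + q) = (u - p) + (v - q)" for u v p q :: real by simp
  have indm[measurable]: "indicator {c<..d} \<in> borel_measurable ?\<mu>" for c d :: real
    by (intro measurable_restrict_space1 borel_measurable_indicator) auto
  show ?thesis unfolding is_stochastic_integral_def
  proof (rule conjI[OF _ exI[of _ q, OF exI[of _ \<sigma>, OF exI[of _ b]]]], goal_cases meas lim)
    case meas
    show ?case by measurable
  next
    case lim
    show ?case
    proof (intro conjI allI)
    show "(\<lambda>r. \<integral>\<^sup>+x. ennreal ((g x + g' x - (\<Sum>i<q r. b r i * indicator {\<sigma> r i<..\<sigma> r (Suc i)} x))\<^sup>2) \<partial>?\<mu>) \<longlonglongrightarrow> 0"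
      unfolding 3(3) id
      by (rule nn_integral_square_add_tendsto_0[OF 1(3) _ 2(3)]) measurable
    show "(\<lambda>r. \<integral>\<^sup>+\<omega>. ennreal ((X \<omega> + X' \<omega> - (\<Sum>i<q r. b r i * (Y (\<sigma> r (Suc i)) \<omega> - Y (\<sigma> r i) \<omega>)))\<^sup>2) \<partial>M) \<longlonglongrightarrow> 0"
      \<comment> \<open>The identity for arbitrary \<open>w\<close> is applied to the path of
        \<open>Y\<close> at a fixed outcome.\<close>
      unfolding 3(4)[of _ "\<lambda>t. Y t _"] id
    proof (rule nn_integral_square_add_tendsto_0[OF 1(4) _ 2(4)])
      show "(\<lambda>\<omega>. X \<omega> - (\<Sum>i<m r. a r i * (Y (\<tau> r (Suc i)) \<omega> - Y (\<tau> r i) \<omega>))) \<in> borel_measurable M" for r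
        by (intro borel_measurable_diff borel_measurable_sum borel_measurable_times 1(5)) (auto)
      show "(\<lambda>\<omega>. X' \<omega> - (\<Sum>i<m' r. a' r i * (Y (\<tau>' r (Suc i)) \<omega> - Y (\<tau>' r i) \<omega>))) \<in> borel_measurable M" for r
        by (intro borel_measurable_diff borel_measurable_sum borel_measurable_times 2(5)) (auto)
    qed
    qed (use 3 in auto)
  qed
qed

subsection \<open>Gaussianity of the coefficients\<close>

lemma (in prob_space) char_scaled_normal:
  assumes X: "distributed M lborel X (\<lambda>x. ennreal (normal_density 0 \<sigma> x))" and "\<sigma> > 0"
  shows "char (distr M borel (\<lambda>\<omega>. a * X \<omega>)) t = complex_of_real (exp (- ((t * a * \<sigma>)\<^sup>2) / 2))"
proof -
  have [measurable]: "X \<in> borel_measurable M"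
    using distributed_measurable[OF X] by simp
  have Z: "distributed M lborel (\<lambda>\<omega>. X \<omega> / \<sigma>) (\<lambda>x. ennreal (std_normal_density x))"
    using X normal_standard_normal_convert[OF \<open>\<sigma> > 0\<close>, of X 0] by (simp only: diff_zero)
  have "complex_of_real (exp (- ((t * a * \<sigma>)\<^sup>2) / 2)) = char (distr M lborel (\<lambda>\<omega>. X \<omega> / \<sigma>)) (t * a * \<sigma>)"
    using distributed_distr_eq_density[OF Z] by (simp add: char_std_normal_distribution)
  also have "\<dots> = (CLINT \<omega>|M. iexp (t * a * \<sigma> * (X \<omega> / \<sigma>)))"
    unfolding char_def by (subst integral_distr) auto
  also have "\<dots> = (CLINT \<omega>|M. iexp (t * (a * X \<omega>)))"
    using \<open>\<sigma> > 0\<close> by (simp add: mult.assoc)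
  also have "\<dots> = char (distr M borel (\<lambda>\<omega>. a * X \<omega>)) t"
    unfolding char_def by (subst integral_distr) auto
  finally show ?thesis by simp
qed

text \<open>Independent increments turn the characteristic function into a product, and each centred
  Gaussian factor adds its variance to the exponent.\<close>

lemma char_brownian_step:
  assumes W: "brownian_motion M W" and \<tau>: "mono_on {..m} \<tau>" "\<tau> ` {..m} \<subseteq> {0..1}"
  shows "char (distr M borel (\<lambda>\<omega>. \<Sum>i<m. a i * (W (\<tau> (Suc i)) \<omega> - W (\<tau> i) \<omega>))) t =
    complex_of_real (exp (- (t\<^sup>2 * (\<Sum>i<m. (a i)\<^sup>2 * (\<tau> (Suc i) - \<tau> i))) / 2))"
proof -
  interpret prob_space M using W by (simp add: brownian_motion_def)
  have "indep_vars (\<lambda>_. borel) (\<lambda>i \<omega>. W (\<tau> (Suc i)) \<omega> - W (\<tau> i) \<omega>) {..<m}"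
    using W \<tau> by (simp add: brownian_motion_def)
  then have "indep_vars (\<lambda>_. borel) (\<lambda>i \<omega>. a i * (W (\<tau> (Suc i)) \<omega> - W (\<tau> i) \<omega>)) {..<m}"
    by (rule indep_vars_compose2[where Y = "\<lambda>i x. a i * x"]) simp
  then have "char (distr M borel (\<lambda>\<omega>. \<Sum>i<m. a i * (W (\<tau> (Suc i)) \<omega> - W (\<tau> i) \<omega>))) t =
      (\<Prod>i<m. char (distr M borel (\<lambda>\<omega>. a i * (W (\<tau> (Suc i)) \<omega> - W (\<tau> i) \<omega>))) t)"
    by (rule char_distr_sum)
  also have "\<dots> = (\<Prod>i<m. complex_of_real (exp (- (t\<^sup>2 * ((a i)\<^sup>2 * (\<tau> (Suc i) - \<tau> i))) / 2)))"
  proof (intro prod.cong refl)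
    fix i assume "i \<in> {..<m}"
    then have i: "\<tau> i \<le> \<tau> (Suc i)" "0 \<le> \<tau> i" "\<tau> (Suc i) \<le> 1"
      using monotone_onD[OF \<tau>(1), of i "Suc i"] \<tau>(2) by (auto simp: image_subset_iff)
    show "char (distr M borel (\<lambda>\<omega>. a i * (W (\<tau> (Suc i)) \<omega> - W (\<tau> i) \<omega>))) t =
        complex_of_real (exp (- (t\<^sup>2 * ((a i)\<^sup>2 * (\<tau> (Suc i) - \<tau> i))) / 2))"
    \<comment> \<open>The partition is only weakly increasing, while \<open>brownian_motion\<close>
      provides a density only for s < t. An empty cell contributes the constant 0.\<close>
    proof (cases "\<tau> i = \<tau> (Suc i)")
      case True
      then show ?thesis by (simp add: char_def integral_distr prob_space del: distr_const)
    next
      case False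
      with i have "\<tau> i < \<tau> (Suc i)" by simp
      then have "distributed M lborel (\<lambda>\<omega>. W (\<tau> (Suc i)) \<omega> - W (\<tau> i) \<omega>)
          (\<lambda>x. ennreal (normal_density 0 (sqrt (\<tau> (Suc i) - \<tau> i)) x))"
        using W i unfolding brownian_motion_def by blast
      from char_scaled_normal[OF this, of "a i" t] \<open>\<tau> i < \<tau> (Suc i)\<close> show ?thesis
        by (simp add: power_mult_distrib mult.assoc)
    qed
  qed
  also have "\<dots> = complex_of_real (exp (\<Sum>i<m. - (t\<^sup>2 * ((a i)\<^sup>2 * (\<tau> (Suc i) - \<tau> i))) / 2))"
    by (simp add: exp_sum)
  also have "(\<Sum>i<m. - (t\<^sup>2 * ((a i)\<^sup>2 * (\<tau> (Suc i) - \<tau> i))) / 2) =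
      - (t\<^sup>2 * (\<Sum>i<m. (a i)\<^sup>2 * (\<tau> (Suc i) - \<tau> i))) / 2"
    by (simp add: sum_distrib_left sum_negf sum_divide_distrib)
  finally show ?thesis .
qed

section \<open>Step functions on the unit interval\<close>

lemma interval_lebesgue_on_unit:
  assumes "0 \<le> u" "u \<le> v" "v \<le> (1::real)"
  shows "{u<..v} \<in> sets (lebesgue_on {0..1})" "emeasure (lebesgue_on {0..1}) {u<..v} = ennreal (v - u)"
    "measure (lebesgue_on {0..1}) {u<..v} = v - u"
    "integrable (lebesgue_on {0..1}) (indicator {u<..v} :: real \<Rightarrow> real)"
proof -
  have sub: "{u<..v} \<subseteq> {0..1}" using assms by auto
  then show 1: "{u<..v} \<in> sets (lebesgue_on {0..1})"
    by (subst sets_restrict_space_iff) auto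
  show 2: "emeasure (lebesgue_on {0..1}) {u<..v} = ennreal (v - u)"
    using sub assms by (subst emeasure_restrict_space) auto
  show "measure (lebesgue_on {0..1}) {u<..v} = v - u"
    using assms unfolding measure_def 2 by simp
  show "integrable (lebesgue_on {0..1}) (indicator {u<..v} :: real \<Rightarrow> real)"
    using 1 2 by (intro integrable_real_indicator) auto
qed

lemma finite_measure_unit: "finite_measure (lebesgue_on {0..1::real})"
  by (rule finite_measureI) (simp add: emeasure_restrict_space)

lemma indicator_L2_unit:
  assumes "0 \<le> u" "u \<le> v" "v \<le> (1::real)"
  shows "(indicator {u<..v} :: real \<Rightarrow> real) \<in> L2 (lebesgue_on {0..1})"
proof -
  have "(indicator {u<..v} x :: real)\<^sup>2 = indicator {u<..v} x" for x
    by (simp add: indicator_def)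
  then show ?thesis
    using interval_lebesgue_on_unit(1,4)[OF assms]
    by (auto simp: L2_def)
qed

lemma partition_le:
  assumes "mono_on {..m} \<tau>" "\<tau> ` {..m} \<subseteq> {0..1::real}" "i < m"
  shows "0 \<le> \<tau> i" "\<tau> i \<le> \<tau> (Suc i)" "\<tau> (Suc i) \<le> 1"
  using monotone_onD[OF assms(1), of i "Suc i"] assms by (auto simp: image_subset_iff)

lemma step_L2_unit:
  assumes "mono_on {..m} \<tau>" "\<tau> ` {..m} \<subseteq> {0..1::real}"
  shows "(\<lambda>x. \<Sum>i<m. a i * indicator {\<tau> i<..\<tau> (Suc i)} x) \<in> L2 (lebesgue_on {0..1})"
  using partition_le[OF assms] by (intro L2_sum L2_cmult indicator_L2_unit) auto

text \<open>The cells are pairwise disjoint because \<tau> is monotone, so at most one summand is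
  nonzero at \<open>x\<close> and squaring acts on its weight alone.\<close>

lemma step_square:
  fixes \<tau> a :: "nat \<Rightarrow> real"
  assumes \<tau>: "mono_on {..m} \<tau>"
  shows "(\<Sum>i<m. a i * indicator {\<tau> i<..\<tau> (Suc i)} x)\<^sup>2 = (\<Sum>i<m. (a i)\<^sup>2 * indicator {\<tau> i<..\<tau> (Suc i)} x)"
proof (cases "\<exists>i<m. x \<in> {\<tau> i<..\<tau> (Suc i)}")
  case True
  then obtain i where i: "i < m" "x \<in> {\<tau> i<..\<tau> (Suc i)}" by blast
  have "x \<notin> {\<tau> l<..\<tau> (Suc l)}" if "l < m" "l \<noteq> i" for l
  proof (cases "l < i")
    case True
    then have "\<tau> (Suc l) \<le> \<tau> i" using \<tau> i by (intro monotone_onD[OF \<tau>]) auto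
    then show ?thesis using i by auto
  next
    case False
    then have "\<tau> (Suc i) \<le> \<tau> l" using \<tau> i that by (intro monotone_onD[OF \<tau>]) auto
    then show ?thesis using i by auto
  qed
  then have "b l * indicator {\<tau> l<..\<tau> (Suc l)} x = (if l = i then b i else 0)" if "l < m" for l and b :: "nat \<Rightarrow> real"
    using that i by (auto simp: indicator_def)
  then have "(\<Sum>l<m. b l * indicator {\<tau> l<..\<tau> (Suc l)} x) = (\<Sum>l<m. if l = i then b i else 0)" for b :: "nat \<Rightarrow> real"
    by (intro sum.cong) auto
  then show ?thesis using i by simp
next
  case False
  then have "b l * indicator {\<tau> l<..\<tau> (Suc l)} x = 0" if "l < m" for l and b :: "nat \<Rightarrow> real"
    using that by (auto simp: indicator_def)
  then have "(\<Sum>l<m. b l * indicator {\<tau> l<..\<tau> (Suc l)} x) = 0" for b :: "nat \<Rightarrow> real"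
    by (intro sum.neutral) auto
  then show ?thesis by simp
qed

lemma integral_step_square:
  fixes \<tau> a :: "nat \<Rightarrow> real"
  assumes "mono_on {..m} \<tau>" "\<tau> ` {..m} \<subseteq> {0..1}"
  shows "(\<integral>x. (\<Sum>i<m. a i * indicator {\<tau> i<..\<tau> (Suc i)} x)\<^sup>2 \<partial>lebesgue_on {0..1}) =
    (\<Sum>i<m. (a i)\<^sup>2 * (\<tau> (Suc i) - \<tau> i))"
proof -
  note le = interval_lebesgue_on_unit[OF partition_le[OF assms]]
  have "(\<integral>x. (\<Sum>i<m. (a i)\<^sup>2 * indicator {\<tau> i<..\<tau> (Suc i)} x) \<partial>lebesgue_on {0..1}) =
      (\<Sum>i<m. (\<integral>x. (a i)\<^sup>2 * indicator {\<tau> i<..\<tau> (Suc i)} x \<partial>lebesgue_on {0..1}))"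
    using le by (intro Bochner_Integration.integral_sum integrable_mult_right) auto
  also have "\<dots> = (\<Sum>i<m. (a i)\<^sup>2 * (\<tau> (Suc i) - \<tau> i))"
    using le by (intro sum.cong) (auto simp: Int_absorb2 sets.sets_into_space[of "{_<.._}" "lebesgue_on {0..1}", simplified])
  finally show ?thesis
    by (simp only: step_square[OF assms(1)])
qed

section \<open>Characteristic functions under mean-square convergence, and exponential
  moments\<close>

lemma cmod_iexp_diff: "cmod (iexp a - iexp b) \<le> \<bar>a - b\<bar>"
proof -
  have "iexp a - iexp b = iexp b * (iexp (a - b) - 1)"
    by (simp add: algebra_simps exp_add[symmetric])
  then have "cmod (iexp a - iexp b) = cmod (iexp (a - b) - 1)"
    by (simp add: norm_mult)
  also have "\<dots> \<le> \<bar>a - b\<bar>"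
    using iexp_approx1[of "a - b" 0] by simp
  finally show ?thesis .
qed

text \<open>Since \<open>iexp\<close> is 1-Lipschitz, the characteristic functions differ by at most
  |t| times the L2-distance. The bounded function \<open>h\<close> is integrated in place of |X - S
  r|, as nothing is assumed on the integrability of \<open>X\<close>.\<close>

lemma (in prob_space) char_L2_limit:
  assumes [measurable]: "X \<in> borel_measurable M" "\<And>r. S r \<in> borel_measurable M"
    and lim: "(\<lambda>r. \<integral>\<^sup>+\<omega>. ennreal ((X \<omega> - S r \<omega>)\<^sup>2) \<partial>M) \<longlonglongrightarrow> 0"
  shows "(\<lambda>r. char (distr M borel (S r)) t) \<longlonglongrightarrow> char (distr M borel X) t"
proof -
  define h where "h = (\<lambda>r \<omega>. cmod (iexp (t * S r \<omega>) - iexp (t * X \<omega>)))"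
  have [measurable]: "h r \<in> borel_measurable M" for r
    unfolding h_def by measurable
  have h2: "\<And>r \<omega>. \<bar>h r \<omega>\<bar> \<le> 2"
  proof -
    fix r \<omega>
    show "\<bar>h r \<omega>\<bar> \<le> 2"
      unfolding h_def using norm_triangle_ineq4[of "iexp (t * S r \<omega>)" "iexp (t * X \<omega>)"] by simp
  qed
  then have hint: "integrable M (h r)" for r
    by (auto intro!: integrable_const_bound[where B = 2])
  have h2int: "integrable M (\<lambda>\<omega>. (h r \<omega>)\<^sup>2)" for r
  proof (rule integrable_const_bound[where B = "2\<^sup>2"])
    show "AE \<omega> in M. norm ((h r \<omega>)\<^sup>2) \<le> 2\<^sup>2"
    proof (rule AE_I2)
      fix \<omega>
      show "norm ((h r \<omega>)\<^sup>2) \<le> 2\<^sup>2"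
        using power_mono[OF h2[of r \<omega>] abs_ge_zero, of 2] by (simp only: real_norm_def power_abs)
    qed
  qed simp
  have hle: "h r \<omega> \<le> \<bar>t\<bar> * \<bar>X \<omega> - S r \<omega>\<bar>" for r \<omega>
    unfolding h_def using cmod_iexp_diff[of "t * S r \<omega>" "t * X \<omega>"]
    by (simp add: abs_mult[symmetric] algebra_simps abs_minus_commute)
  have le: "ennreal ((\<integral>\<omega>. h r \<omega> \<partial>M)\<^sup>2) \<le> ennreal (t\<^sup>2) * (\<integral>\<^sup>+\<omega>. ennreal ((X \<omega> - S r \<omega>)\<^sup>2) \<partial>M)" for r
  proof -
    \<comment> \<open>Jensen's inequality for the square, in the form that a variance is
      nonnegative.\<close>
    have "(\<integral>\<omega>. h r \<omega> \<partial>M)\<^sup>2 \<le> (\<integral>\<omega>. (h r \<omega>)\<^sup>2 \<partial>M)"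
      using variance_eq[OF hint[of r] h2int[of r]] variance_positive[of "h r"] by simp
    then have "ennreal ((\<integral>\<omega>. h r \<omega> \<partial>M)\<^sup>2) \<le> (\<integral>\<^sup>+\<omega>. ennreal ((h r \<omega>)\<^sup>2) \<partial>M)"
      using h2int[of r] by (simp add: nn_integral_eq_integral ennreal_leI)
    also have "\<dots> \<le> (\<integral>\<^sup>+\<omega>. ennreal (t\<^sup>2) * ennreal ((X \<omega> - S r \<omega>)\<^sup>2) \<partial>M)"
    proof (rule nn_integral_mono)
      fix \<omega>
      have "(h r \<omega>)\<^sup>2 \<le> (\<bar>t\<bar> * \<bar>X \<omega> - S r \<omega>\<bar>)\<^sup>2"
        using hle by (intro power_mono) (auto simp: h_def)
      then show "ennreal ((h r \<omega>)\<^sup>2) \<le> ennreal (t\<^sup>2) * ennreal ((X \<omega> - S r \<omega>)\<^sup>2)"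
        by (simp add: power_mult_distrib ennreal_mult[symmetric] ennreal_leI)
    qed
    also have "\<dots> = ennreal (t\<^sup>2) * (\<integral>\<^sup>+\<omega>. ennreal ((X \<omega> - S r \<omega>)\<^sup>2) \<partial>M)"
      by (rule nn_integral_cmult) simp
    finally show ?thesis .
  qed
  have "(\<lambda>r. ennreal (t\<^sup>2) * (\<integral>\<^sup>+\<omega>. ennreal ((X \<omega> - S r \<omega>)\<^sup>2) \<partial>M)) \<longlonglongrightarrow> ennreal (t\<^sup>2) * 0"
    by (intro ennreal_tendsto_cmult lim) simp
  then have lim': "(\<lambda>r. ennreal (t\<^sup>2) * (\<integral>\<^sup>+\<omega>. ennreal ((X \<omega> - S r \<omega>)\<^sup>2) \<partial>M)) \<longlonglongrightarrow> 0"
    by (simp only: mult_zero_right)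
  have "(\<lambda>r. ennreal ((\<integral>\<omega>. h r \<omega> \<partial>M)\<^sup>2)) \<longlonglongrightarrow> 0"
    by (rule tendsto_sandwich[OF eventuallyI eventuallyI tendsto_const lim']) (rule zero_le, rule le)
  then have "(\<lambda>r. (\<integral>\<omega>. h r \<omega> \<partial>M)\<^sup>2) \<longlonglongrightarrow> 0"
    using tendsto_ennreal_iff[of "\<lambda>r. (\<integral>\<omega>. h r \<omega> \<partial>M)\<^sup>2" sequentially 0] by simp
  then have h0: "(\<lambda>r. \<integral>\<omega>. h r \<omega> \<partial>M) \<longlonglongrightarrow> 0"
    using tendsto_real_sqrt[of "\<lambda>r. (\<integral>\<omega>. h r \<omega> \<partial>M)\<^sup>2" 0 sequentially] by (simp add: tendsto_rabs_zero_iff)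
  have "(\<lambda>r. char (distr M borel (S r)) t - char (distr M borel X) t) \<longlonglongrightarrow> 0"
  proof (rule Lim_null_comparison[OF _ h0], rule eventuallyI)
    fix r
    have "char (distr M borel (S r)) t - char (distr M borel X) t = (CLINT \<omega>|M. iexp (t * S r \<omega>) - iexp (t * X \<omega>))"
      unfolding char_def by (simp add: integral_distr integrable_iexp)
    then show "cmod (char (distr M borel (S r)) t - char (distr M borel X) t) \<le> (\<integral>\<omega>. h r \<omega> \<partial>M)"
      unfolding h_def by (metis integral_norm_bound)
  qed
  then show ?thesis by (rule LIM_zero_cancel)
qed

text \<open>Completing the square: the exponential tilt moves the mean to
  \<open>l * \<sigma>\<^sup>2\<close> and keeps the variance, so what remains is again a density of
  total mass 1.\<close>

lemma exp_normal_density: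
  assumes "\<sigma> > 0"
  shows "exp (l * x) * normal_density 0 \<sigma> x = exp (l\<^sup>2 * \<sigma>\<^sup>2 / 2) * normal_density (l * \<sigma>\<^sup>2) \<sigma> x"
proof -
  have "l * x + - (x - 0)\<^sup>2 / (2 * \<sigma>\<^sup>2) = l\<^sup>2 * \<sigma>\<^sup>2 / 2 + - (x - l * \<sigma>\<^sup>2)\<^sup>2 / (2 * \<sigma>\<^sup>2)"
    using assms by (simp add: field_simps power2_eq_square)
  then have "exp (l * x) * exp (- (x - 0)\<^sup>2 / (2 * \<sigma>\<^sup>2)) = exp (l\<^sup>2 * \<sigma>\<^sup>2 / 2) * exp (- (x - l * \<sigma>\<^sup>2)\<^sup>2 / (2 * \<sigma>\<^sup>2))"
    by (simp only: exp_add[symmetric])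
  then show ?thesis
    unfolding normal_density_def by (simp add: mult.left_commute)
qed

text \<open>By Levy's uniqueness theorem the characteristic function fixes the law as a centred
  normal one. Integrability and value of the exponential moment then both come from the tilted
  density.\<close>

lemma (in prob_space) mgf_of_char:
  assumes [measurable]: "X \<in> borel_measurable M" and "v > 0"
    and char: "\<And>t. char (distr M borel X) t = complex_of_real (exp (- (t\<^sup>2 * v) / 2))"
  shows "integrable M (\<lambda>\<omega>. exp (l * X \<omega>))" "(\<integral>\<omega>. exp (l * X \<omega>) \<partial>M) = exp (l\<^sup>2 * v / 2)"
proof -
  let ?N = "density lborel (\<lambda>x. ennreal (normal_density 0 (sqrt v) x))"
  interpret N: prob_space ?N
    using \<open>v > 0\<close> by (intro prob_space_normal_density) simp
  have "distributed ?N lborel (\<lambda>x. x) (\<lambda>x. ennreal (normal_density 0 (sqrt v) x))"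
  proof -
    have "distr ?N lborel (\<lambda>x. x) = distr ?N ?N (\<lambda>x. x)"
      by (rule distr_cong) simp_all
    then show ?thesis
      unfolding distributed_def by simp
  qed
  from N.char_scaled_normal[OF this, of 1] \<open>v > 0\<close>
  have "char (distr ?N borel (\<lambda>x. x)) t = complex_of_real (exp (- (t\<^sup>2 * v) / 2))" for t
    by (simp add: power_mult_distrib)
  moreover have "distr ?N borel (\<lambda>x. x) = ?N"
  proof -
    have "distr ?N borel (\<lambda>x. x) = distr ?N ?N (\<lambda>x. x)"
      by (rule distr_cong) simp_all
    then show ?thesis by simp
  qed
  ultimately have "char (distr M borel X) = char ?N"
    using char by auto
  moreover have "real_distribution (distr M borel X)"
    by (rule real_distribution_distr) simp
  moreover have "real_distribution ?N"
    by (intro real_distribution.intro N.prob_space_axioms real_distribution_axioms.intro) auto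
  ultimately have eq: "distr M borel X = ?N"
    by (intro Levy_uniqueness)
  have pt: "normal_density 0 (sqrt v) x * exp (l * x) = exp (l\<^sup>2 * v / 2) * normal_density (l * v) (sqrt v) x" for x
    using exp_normal_density[of "sqrt v" l x] \<open>v > 0\<close> by (simp add: mult.commute)
  have "integrable ?N (\<lambda>x. exp (l * x))"
    using \<open>v > 0\<close> by (subst integrable_density) (auto simp: pt)
  then show "integrable M (\<lambda>\<omega>. exp (l * X \<omega>))"
    unfolding eq[symmetric] by (subst (asm) integrable_distr_eq) auto
  have "(\<integral>x. exp (l * x) \<partial>?N) = exp (l\<^sup>2 * v / 2)"
    using \<open>v > 0\<close> by (subst integral_density) (auto simp: pt)
  then show "(\<integral>\<omega>. exp (l * X \<omega>) \<partial>M) = exp (l\<^sup>2 * v / 2)"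
    unfolding eq[symmetric] by (subst (asm) integral_distr) auto
qed

text \<open>\<open>observation\<close> integrates the drift over an interval that grows with t. Over
  the fixed unit interval its increments become inner products of \<open>f\<close> with indicators
  of cells.\<close>

lemma integral_unit_increment:
  fixes f :: "real \<Rightarrow> real"
  assumes f: "integrable (lebesgue_on {0..1}) f" and uv: "0 \<le> u" "u \<le> v" "v \<le> 1"
  shows "(\<integral>x. f x \<partial>lebesgue_on {0..v}) - (\<integral>x. f x \<partial>lebesgue_on {0..u}) =
    (\<integral>x. f x * indicator {u<..v} x \<partial>lebesgue_on {0..1})"
proof -
  have sub: "(\<integral>x. f x \<partial>lebesgue_on {0..t}) = (\<integral>x. f x * indicator {0..t} x \<partial>lebesgue_on {0..1})"
    and int: "integrable (lebesgue_on {0..1}) (\<lambda>x. f x * indicator {0..t} x)" if "0 \<le> t" "t \<le> 1" for t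
  proof -
    have "(\<integral>x. f x \<partial>lebesgue_on {0..t}) = (\<integral>x. indicator {0..t} x * f x \<partial>lebesgue)"
      by (subst integral_restrict_space) auto
    also have "\<dots> = (\<integral>x. indicator {0..1} x * (f x * indicator {0..t} x) \<partial>lebesgue)"
      using that by (intro Bochner_Integration.integral_cong) (auto simp: indicator_def)
    also have "\<dots> = (\<integral>x. f x * indicator {0..t} x \<partial>lebesgue_on {0..1})"
      by (subst integral_restrict_space) auto
    finally show "(\<integral>x. f x \<partial>lebesgue_on {0..t}) = (\<integral>x. f x * indicator {0..t} x \<partial>lebesgue_on {0..1})" .
    have "indicator {0..t} \<in> borel_measurable (lebesgue_on {0..1::real})"
      by (intro measurable_restrict_space1 borel_measurable_indicator) auto
    then show "integrable (lebesgue_on {0..1}) (\<lambda>x. f x * indicator {0..t} x)"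
      using borel_measurable_integrable[OF f]
      by (intro Bochner_Integration.integrable_bound[OF f] borel_measurable_times) (auto simp: abs_mult mult_left_le)
  qed
  have "f x * indicator {u<..v} x = f x * indicator {0..v} x - f x * indicator {0..u} x" for x
    using uv by (auto simp: indicator_def)
  then have "(\<integral>x. f x * indicator {u<..v} x \<partial>lebesgue_on {0..1}) =
      (\<integral>x. f x * indicator {0..v} x - f x * indicator {0..u} x \<partial>lebesgue_on {0..1})"
    by (intro Bochner_Integration.integral_cong refl)
  also have "\<dots> = (\<integral>x. f x * indicator {0..v} x \<partial>lebesgue_on {0..1}) - (\<integral>x. f x * indicator {0..u} x \<partial>lebesgue_on {0..1})"
    using uv by (intro Bochner_Integration.integral_diff int) auto
  also have "\<dots> = (\<integral>x. f x \<partial>lebesgue_on {0..v}) - (\<integral>x. f x \<partial>lebesgue_on {0..u})"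
    using uv by (intro arg_cong2[of _ _ _ _ "(-)"] sub[symmetric]) auto
  finally show ?thesis by simp
qed

lemma L2_unit_integrable:
  assumes "f \<in> L2 (lebesgue_on {0..1})"
  shows "integrable (lebesgue_on {0..1}) f"
proof -
  interpret finite_measure "lebesgue_on {0..1::real}" by (rule finite_measure_unit)
  have "(\<lambda>_. 1) \<in> L2 (lebesgue_on {0..1::real})" by (simp add: L2_def)
  from L2_mult_integrable[OF assms this] show ?thesis by simp
qed

text \<open>The sums of increments split into the drift against the step function \<open>h r\<close>
  and a scaled Brownian sum \<open>S r\<close>. After centring and scaling, \<open>Z\<close> is the
  mean-square limit of \<open>S r\<close>, whose variance is the squared norm of \<open>h r\<close>
  and tends to \<open>v\<close>.\<close>

lemma stochastic_integral_mgf: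
  assumes W: "brownian_motion M W" and "n \<ge> 1"
    and f: "f \<in> L2 (lebesgue_on {0..1})" and g: "g \<in> L2 (lebesgue_on {0..1})"
    and X: "is_stochastic_integral M (observation W n f) g X"
    and v: "(\<integral>x. (g x)\<^sup>2 \<partial>lebesgue_on {0..1}) = v" "v > 0"
  defines "Z \<equiv> \<lambda>\<omega>. sqrt (real n) * (X \<omega> - (\<integral>x. f x * g x \<partial>lebesgue_on {0..1}))"
  shows "integrable M (\<lambda>\<omega>. exp (l * Z \<omega>))" "(\<integral>\<omega>. exp (l * Z \<omega>) \<partial>M) = exp (l\<^sup>2 * v / 2)"
proof -
  interpret prob_space M using W by (simp add: brownian_motion_def)
  let ?\<mu> = "lebesgue_on {0..1::real}"
  obtain m :: "nat \<Rightarrow> nat" and \<tau> a :: "nat \<Rightarrow> nat \<Rightarrow> real" where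
      \<tau>: "\<And>r. mono_on {..m r} (\<tau> r)" "\<And>r. \<tau> r ` {..m r} \<subseteq> {0..1}" and
      limg: "(\<lambda>r. \<integral>\<^sup>+x. ennreal ((g x - (\<Sum>i<m r. a r i * indicator {\<tau> r i<..\<tau> r (Suc i)} x))\<^sup>2) \<partial>?\<mu>) \<longlonglongrightarrow> 0" and
      limX: "(\<lambda>r. \<integral>\<^sup>+\<omega>. ennreal ((X \<omega> - (\<Sum>i<m r. a r i * (observation W n f (\<tau> r (Suc i)) \<omega>
          - observation W n f (\<tau> r i) \<omega>)))\<^sup>2) \<partial>M) \<longlonglongrightarrow> 0" and
      Xm: "X \<in> borel_measurable M"
    using X unfolding is_stochastic_integral_def by blast
  define h where "h = (\<lambda>r x. \<Sum>i<m r. a r i * indicator {\<tau> r i<..\<tau> r (Suc i)} x :: real)"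
  define S where "S = (\<lambda>r \<omega>. \<Sum>i<m r. a r i * (W (\<tau> r (Suc i)) \<omega> - W (\<tau> r i) \<omega>))"
  have h: "h r \<in> L2 ?\<mu>" for r
    unfolding h_def by (rule step_L2_unit[OF \<tau>])
  have Wm: "W t \<in> borel_measurable M" if "t \<in> {0..1}" for t
    using W that by (simp add: brownian_motion_def)
  have \<tau>01: "\<tau> r i \<in> {0..1}" if "i \<le> m r" for r i
    using \<tau>(2)[of r] that by auto
  have Sm[measurable]: "S r \<in> borel_measurable M" for r
    unfolding S_def by (intro borel_measurable_sum borel_measurable_times borel_measurable_diff Wm \<tau>01) auto
  note [measurable] = Xm
  have limh: "(\<lambda>r. \<integral>x. (g x - h r x)\<^sup>2 \<partial>?\<mu>) \<longlonglongrightarrow> 0"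
  proof -
    have "(\<lambda>r. ennreal (\<integral>x. (g x - h r x)\<^sup>2 \<partial>?\<mu>)) \<longlonglongrightarrow> ennreal 0"
      using limg L2_integrable_square[OF L2_diff[OF g h]] by (simp add: h_def nn_integral_eq_integral)
    then show ?thesis
      by (subst (asm) tendsto_ennreal_iff) auto
  qed
  \<comment> \<open>The approximating sums carry the drift against \<open>h r\<close>, whereas
    \<open>Z\<close> is centred with the drift against \<open>g\<close>; \<delta> is this
    deterministic gap.\<close>
  define \<delta> where "\<delta> = (\<lambda>r. (\<integral>x. f x * h r x \<partial>?\<mu>) - (\<integral>x. f x * g x \<partial>?\<mu>))"
  have \<delta>: "\<delta> \<longlonglongrightarrow> 0"
    using L2_tendsto_inner[OF f g h limh] unfolding \<delta>_def by (rule LIM_zero)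
  have obs: "(\<Sum>i<m r. a r i * (observation W n f (\<tau> r (Suc i)) \<omega> - observation W n f (\<tau> r i) \<omega>)) =
      (\<integral>x. f x * h r x \<partial>?\<mu>) + S r \<omega> / sqrt (real n)" for r \<omega>
  proof -
    have "observation W n f (\<tau> r (Suc i)) \<omega> - observation W n f (\<tau> r i) \<omega> =
        (\<integral>x. f x * indicator {\<tau> r i<..\<tau> r (Suc i)} x \<partial>?\<mu>) + (W (\<tau> r (Suc i)) \<omega> - W (\<tau> r i) \<omega>) / sqrt (real n)"
      if "i < m r" for i
      using integral_unit_increment[OF L2_unit_integrable[OF f] partition_le[OF \<tau> that]]
      unfolding observation_def by (simp add: diff_divide_distrib)
    moreover have "(\<integral>x. f x * h r x \<partial>?\<mu>) = (\<Sum>i<m r. a r i * (\<integral>x. f x * indicator {\<tau> r i<..\<tau> r (Suc i)} x \<partial>?\<mu>))"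
    proof -
      have "(\<integral>x. f x * h r x \<partial>?\<mu>) = (\<integral>x. (\<Sum>i<m r. a r i * (f x * indicator {\<tau> r i<..\<tau> r (Suc i)} x)) \<partial>?\<mu>)"
        unfolding h_def by (simp only: sum_distrib_left mult.left_commute)
      also have "\<dots> = (\<Sum>i<m r. \<integral>x. a r i * (f x * indicator {\<tau> r i<..\<tau> r (Suc i)} x) \<partial>?\<mu>)"
        by (intro Bochner_Integration.integral_sum integrable_mult_right L2_mult_integrable[OF f] indicator_L2_unit
            partition_le[OF \<tau>]) auto
      finally show ?thesis by simp
    qed
    ultimately show ?thesis
      by (simp add: S_def sum.distrib distrib_left sum_divide_distrib)
  qed
  have "(\<lambda>r. \<integral>\<^sup>+\<omega>. ennreal (((X \<omega> - ((\<integral>x. f x * h r x \<partial>?\<mu>) + S r \<omega> / sqrt (real n))) + \<delta> r)\<^sup>2) \<partial>M) \<longlonglongrightarrow> 0"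
  proof (rule nn_integral_square_add_tendsto_0)
    show "(\<lambda>r. \<integral>\<^sup>+\<omega>. ennreal ((X \<omega> - ((\<integral>x. f x * h r x \<partial>?\<mu>) + S r \<omega> / sqrt (real n)))\<^sup>2) \<partial>M) \<longlonglongrightarrow> 0"
      using limX unfolding obs .
    have "(\<lambda>r. ennreal ((\<delta> r)\<^sup>2)) \<longlonglongrightarrow> ennreal (0\<^sup>2)"
      by (intro tendsto_ennrealI tendsto_power \<delta>)
    then show "(\<lambda>r. \<integral>\<^sup>+\<omega>. ennreal ((\<delta> r)\<^sup>2) \<partial>M) \<longlonglongrightarrow> 0"
      by (simp add: emeasure_space_1)
  qed auto
  then have "(\<lambda>r. ennreal (real n) * (\<integral>\<^sup>+\<omega>. ennreal (((X \<omega> - ((\<integral>x. f x * h r x \<partial>?\<mu>) + S r \<omega> / sqrt (real n))) + \<delta> r)\<^sup>2) \<partial>M))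
      \<longlonglongrightarrow> ennreal (real n) * 0"
    by (intro ennreal_tendsto_cmult) auto
  moreover have "ennreal (real n) * (\<integral>\<^sup>+\<omega>. ennreal (((X \<omega> - ((\<integral>x. f x * h r x \<partial>?\<mu>) + S r \<omega> / sqrt (real n))) + \<delta> r)\<^sup>2) \<partial>M)
      = (\<integral>\<^sup>+\<omega>. ennreal ((Z \<omega> - S r \<omega>)\<^sup>2) \<partial>M)" for r
  proof (subst nn_integral_cmult[symmetric])
    have "Z \<omega> - S r \<omega> = sqrt (real n) * ((X \<omega> - ((\<integral>x. f x * h r x \<partial>?\<mu>) + S r \<omega> / sqrt (real n))) + \<delta> r)" for \<omega>
      using \<open>n \<ge> 1\<close> by (simp add: Z_def \<delta>_def algebra_simps)
    then have "(Z \<omega> - S r \<omega>)\<^sup>2 = real n * ((X \<omega> - ((\<integral>x. f x * h r x \<partial>?\<mu>) + S r \<omega> / sqrt (real n))) + \<delta> r)\<^sup>2" for \<omega>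
      by (simp add: power_mult_distrib)
    then show "(\<integral>\<^sup>+\<omega>. ennreal (real n) * ennreal (((X \<omega> - ((\<integral>x. f x * h r x \<partial>?\<mu>) + S r \<omega> / sqrt (real n))) + \<delta> r)\<^sup>2) \<partial>M)
      = (\<integral>\<^sup>+\<omega>. ennreal ((Z \<omega> - S r \<omega>)\<^sup>2) \<partial>M)"
      by (simp add: ennreal_mult)
  qed auto
  ultimately have limZ: "(\<lambda>r. \<integral>\<^sup>+\<omega>. ennreal ((Z \<omega> - S r \<omega>)\<^sup>2) \<partial>M) \<longlonglongrightarrow> 0"
    by simp
  have Zm[measurable]: "Z \<in> borel_measurable M"
    unfolding Z_def by measurable
  have limv: "(\<lambda>r. \<integral>x. (h r x)\<^sup>2 \<partial>?\<mu>) \<longlonglongrightarrow> v"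
    using L2_tendsto_square[OF g h limh] v(1) by simp
  have "char (distr M borel Z) t = complex_of_real (exp (- (t\<^sup>2 * v) / 2))" for t
  proof (rule LIMSEQ_unique)
    show "(\<lambda>r. char (distr M borel (S r)) t) \<longlonglongrightarrow> char (distr M borel Z) t"
      by (rule char_L2_limit[OF Zm Sm limZ])
    have "char (distr M borel (S r)) t = complex_of_real (exp (- (t\<^sup>2 * (\<integral>x. (h r x)\<^sup>2 \<partial>?\<mu>)) / 2))" for r
      unfolding S_def h_def char_brownian_step[OF W \<tau>] integral_step_square[OF \<tau>] ..
    moreover have "(\<lambda>r. complex_of_real (exp (- (t\<^sup>2 * (\<integral>x. (h r x)\<^sup>2 \<partial>?\<mu>)) / 2)))
        \<longlonglongrightarrow> complex_of_real (exp (- (t\<^sup>2 * v) / 2))"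
      by (intro tendsto_intros limv) simp
    ultimately show "(\<lambda>r. char (distr M borel (S r)) t) \<longlonglongrightarrow> complex_of_real (exp (- (t\<^sup>2 * v) / 2))"
      by simp
  qed
  from mgf_of_char[OF Zm v(2) this] show "integrable M (\<lambda>\<omega>. exp (l * Z \<omega>))" "(\<integral>\<omega>. exp (l * Z \<omega>) \<partial>M) = exp (l\<^sup>2 * v / 2)"
    by auto
qed

subsection \<open>The maximum of the noise\<close>

text \<open>Second moment method for \<open>G\<close>, the sum of exp(l Z_k). Relative to the
  squared mean m^2 exp(l^2), the variance is at most exp(l^2) / m, which is small as long as l^2
  stays well below log m; the choice l^2 = (log m) / 2 makes it 1 / sqrt m. If all Z_k were below l
  / 4, then \<open>G\<close> could not exceed half of its mean.\<close>

lemma (in prob_space) max_ge_of_mgf: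
  fixes Z :: "'i \<Rightarrow> 'a \<Rightarrow> real"
  assumes K: "finite K" "card K \<ge> 256"
    and Zm: "\<And>k. k \<in> K \<Longrightarrow> Z k \<in> borel_measurable M"
    and mgf1: "\<And>k l. k \<in> K \<Longrightarrow> integrable M (\<lambda>\<omega>. exp (l * Z k \<omega>))"
      "\<And>k l. k \<in> K \<Longrightarrow> expectation (\<lambda>\<omega>. exp (l * Z k \<omega>)) = exp (l\<^sup>2 / 2)"
    and mgf2: "\<And>k k' l. k \<in> K \<Longrightarrow> k' \<in> K \<Longrightarrow> k \<noteq> k' \<Longrightarrow> integrable M (\<lambda>\<omega>. exp (l * (Z k \<omega> + Z k' \<omega>)))"
      "\<And>k k' l. k \<in> K \<Longrightarrow> k' \<in> K \<Longrightarrow> k \<noteq> k' \<Longrightarrow> expectation (\<lambda>\<omega>. exp (l * (Z k \<omega> + Z k' \<omega>))) = exp (l\<^sup>2)"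
  shows "prob {\<omega> \<in> space M. \<exists>k\<in>K. Z k \<omega> \<ge> sqrt (ln (card K) / 2) / 4} \<ge> 3 / 4"
proof -
  define m where "m = real (card K)"
  have m: "m \<ge> 256" using K unfolding m_def by linarith
  define l where "l = sqrt (ln m / 2)"
  define G where "G = (\<lambda>\<omega>. \<Sum>k\<in>K. exp (l * Z k \<omega>))"
  have Gm[measurable]: "G \<in> borel_measurable M"
    unfolding G_def using Zm by measurable
  have l2: "l\<^sup>2 = ln m / 2" using m by (simp add: l_def)
  have el: "exp (l\<^sup>2) = sqrt m"
    using m unfolding l2 by (simp add: powr_half_sqrt[symmetric] powr_def)
  have el2: "exp (2 * l\<^sup>2) = m"
    using m unfolding l2 by simp
  have pair: "integrable M (\<lambda>\<omega>. exp (l * Z k \<omega>) * exp (l * Z k' \<omega>))"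
    "expectation (\<lambda>\<omega>. exp (l * Z k \<omega>) * exp (l * Z k' \<omega>)) = sqrt m + (if k = k' then m - sqrt m else 0)"
    if "k \<in> K" "k' \<in> K" for k k'
  proof -
    \<comment> \<open>On the diagonal the product is one exponential with 2 l in place of l, of mean
      exp(2 l^2) = m; off the diagonal the mean is exp(l^2) = sqrt m.\<close>
    have eq: "exp (l * Z k \<omega>) * exp (l * Z k' \<omega>) = (if k = k' then exp ((2 * l) * Z k \<omega>) else exp (l * (Z k \<omega> + Z k' \<omega>)))" for \<omega>
      by (simp add: exp_add[symmetric] distrib_left)
    show "integrable M (\<lambda>\<omega>. exp (l * Z k \<omega>) * exp (l * Z k' \<omega>))"
      unfolding eq using mgf1(1)[OF that(1), of "2 * l"] mgf2(1)[OF that, of l] by (cases "k = k'") simp_all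
    show "expectation (\<lambda>\<omega>. exp (l * Z k \<omega>) * exp (l * Z k' \<omega>)) = sqrt m + (if k = k' then m - sqrt m else 0)"
      unfolding eq using mgf1(2)[OF that(1), of "2 * l"] mgf2(2)[OF that, of l] el el2
      by (cases "k = k'") (simp_all add: power_mult_distrib)
  qed
  have EG: "expectation G = m * exp (l\<^sup>2 / 2)" and iG: "integrable M G"
    unfolding G_def using mgf1 by (auto simp: m_def)
  have G2: "(G \<omega>)\<^sup>2 = (\<Sum>k\<in>K. \<Sum>k'\<in>K. exp (l * Z k \<omega>) * exp (l * Z k' \<omega>))" for \<omega>
    unfolding G_def by (simp add: power2_eq_square sum_product)
  have iG2: "integrable M (\<lambda>\<omega>. (G \<omega>)\<^sup>2)"
    unfolding G2 using pair(1) by auto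
  have "expectation (\<lambda>\<omega>. (G \<omega>)\<^sup>2) = (\<Sum>k\<in>K. \<Sum>k'\<in>K. expectation (\<lambda>\<omega>. exp (l * Z k \<omega>) * exp (l * Z k' \<omega>)))"
    unfolding G2 using pair(1) by (simp add: Bochner_Integration.integral_sum integrable_sum)
  also have "\<dots> = (\<Sum>k\<in>K. \<Sum>k'\<in>K. sqrt m + (if k = k' then m - sqrt m else 0))"
    using pair(2) by (intro sum.cong) auto
  also have "\<dots> = m * (m * sqrt m) + m * (m - sqrt m)"
    using K by (simp add: sum.distrib m_def distrib_left)
  finally have EG2: "expectation (\<lambda>\<omega>. (G \<omega>)\<^sup>2) = m * (m * sqrt m) + m * (m - sqrt m)" .
  have "(exp (l\<^sup>2 / 2))\<^sup>2 = sqrt m"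
    using el by (simp add: exp_double[symmetric])
  then have EGs: "(expectation G)\<^sup>2 = m * (m * sqrt m)"
    unfolding EG by (simp add: power_mult_distrib power2_eq_square)
  define a where "a = m * exp (l\<^sup>2 / 2) / 2"
  have "a > 0" using m by (simp add: a_def)
  have "a\<^sup>2 = m * (m * sqrt m) / 4"
    using EGs unfolding EG a_def by (simp add: power_divide)
  \<comment> \<open>The size 256 = 16^2 = 2^8 is used twice: here it brings the Chebyshev bound 4 /
    sqrt m down to 1 / 4, and below it is equivalent to ln 2 \<le> l^2 / 4, the gap that absorbs the
    factor 1 / 2 in \<open>a\<close>.\<close>
  have "16 \<le> sqrt m"
    using m by (intro real_le_rsqrt) simp
  have "variance G \<le> m * m"
    unfolding variance_eq[OF iG iG2] EG2 EGs using m by (simp add: right_diff_distrib)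
  then have "variance G / a\<^sup>2 \<le> (m * m) / a\<^sup>2"
    by (intro divide_right_mono) auto
  also have "\<dots> = 4 / sqrt m"
    unfolding \<open>a\<^sup>2 = _\<close> using m by (simp add: field_simps)
  also have "\<dots> \<le> 1 / 4"
    using \<open>16 \<le> sqrt m\<close> m by (simp add: field_simps)
  finally have var: "variance G / a\<^sup>2 \<le> 1 / 4" .
  have cheb: "prob {\<omega>\<in>space M. \<bar>G \<omega> - expectation G\<bar> \<ge> a} \<le> 1 / 4"
    by (rule order_trans[OF Chebyshev_inequality[OF Gm iG2 \<open>a > 0\<close>] var])
  have "ln 2 \<le> l\<^sup>2 / 4"
  proof -
    have "ln (256::real) = 8 * ln 2"
      using ln_realpow[of "2::real" 8] by simp
    then have "8 * ln 2 \<le> ln m"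
      using m ln_le_cancel_iff[of 256 m] by linarith
    then show ?thesis unfolding l2 by simp
  qed
  have "l > 0" using m by (simp add: l_def)
  have sub: "{\<omega>\<in>space M. \<not> \<bar>G \<omega> - expectation G\<bar> \<ge> a} \<subseteq> {\<omega> \<in> space M. \<exists>k\<in>K. Z k \<omega> \<ge> l / 4}"
  proof (safe, rule ccontr)
    fix \<omega> assume \<omega>: "\<omega> \<in> space M" "\<not> \<bar>G \<omega> - expectation G\<bar> \<ge> a" "\<not> (\<exists>k\<in>K. Z k \<omega> \<ge> l / 4)"
    have "exp (l * Z k \<omega>) \<le> exp (l\<^sup>2 / 2) / 2" if "k \<in> K" for k
    proof -
      have "l * Z k \<omega> \<le> l * (l / 4)"
        using \<omega>(3) that \<open>l > 0\<close> by (intro mult_left_mono) (auto simp: not_le less_imp_le)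
      also have "\<dots> \<le> l\<^sup>2 / 2 - ln 2"
        using \<open>ln 2 \<le> l\<^sup>2 / 4\<close> by (simp add: power2_eq_square)
      finally have "exp (l * Z k \<omega>) \<le> exp (l\<^sup>2 / 2 - ln 2)"
        by simp
      then show ?thesis by (simp add: exp_diff)
    qed
    then have "G \<omega> \<le> (\<Sum>k\<in>K. exp (l\<^sup>2 / 2) / 2)"
      unfolding G_def by (rule sum_mono)
    also have "\<dots> = a" by (simp add: a_def m_def)
    finally show False
      using \<omega>(2) unfolding EG a_def by (simp add: abs_if split: if_splits)
  qed
  have [measurable]: "{\<omega> \<in> space M. \<exists>k\<in>K. Z k \<omega> \<ge> l / 4} \<in> sets M"
    using Zm K by measurable
  have "1 - 1 / 4 \<le> prob {\<omega>\<in>space M. \<not> \<bar>G \<omega> - expectation G\<bar> \<ge> a}"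
    using cheb by (subst prob_neg) auto
  also have "\<dots> \<le> prob {\<omega> \<in> space M. \<exists>k\<in>K. Z k \<omega> \<ge> l / 4}"
    by (rule finite_measure_mono[OF sub]) measurable
  finally show ?thesis by (simp add: l_def m_def)
qed

text \<open>Markov's inequality: the mean of each absolute value is at most 2 exp(1/2) \<le> 4, and
  the level 16 is four times as large.\<close>

lemma (in prob_space) sum_abs_le_of_mgf:
  fixes Z :: "'i \<Rightarrow> 'a \<Rightarrow> real"
  assumes K: "finite K" "K \<noteq> {}"
    and Zm: "\<And>k. k \<in> K \<Longrightarrow> Z k \<in> borel_measurable M"
    and mgf1: "\<And>k l. k \<in> K \<Longrightarrow> integrable M (\<lambda>\<omega>. exp (l * Z k \<omega>))"
      "\<And>k l. k \<in> K \<Longrightarrow> expectation (\<lambda>\<omega>. exp (l * Z k \<omega>)) = exp (l\<^sup>2 / 2)"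
  shows "prob {\<omega> \<in> space M. (\<Sum>k\<in>K. \<bar>Z k \<omega>\<bar>) \<ge> 16 * card K} \<le> 1 / 4"
proof -
  \<comment> \<open>The factors 1 and - 1 are written out so that \<open>mgf1\<close> applies
    literally with \<open>l\<close> equal to 1 and to - 1.\<close>
  have abs_le: "\<bar>x\<bar> \<le> exp (1 * x) + exp (- 1 * x)" for x :: real
    using exp_ge_add_one_self[of x] exp_ge_add_one_self[of "-x"] exp_gt_zero[of x] exp_gt_zero[of "-x"]
    unfolding mult_1 mult_minus1 by linarith
  have e2: "integrable M (\<lambda>\<omega>. exp (1 * Z k \<omega>) + exp (- 1 * Z k \<omega>))" if "k \<in> K" for k
    using mgf1(1)[OF that] by (intro Bochner_Integration.integrable_add)
  have i: "integrable M (\<lambda>\<omega>. \<bar>Z k \<omega>\<bar>)" if "k \<in> K" for k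
    using Zm[OF that] abs_le by (intro Bochner_Integration.integrable_bound[OF e2[OF that]]) auto
  have "expectation (\<lambda>\<omega>. \<bar>Z k \<omega>\<bar>) \<le> 4" if "k \<in> K" for k
  proof -
    have "expectation (\<lambda>\<omega>. \<bar>Z k \<omega>\<bar>) \<le> expectation (\<lambda>\<omega>. exp (1 * Z k \<omega>) + exp (- 1 * Z k \<omega>))"
      by (intro integral_mono i e2 that abs_le)
    also have "\<dots> = 2 * exp (1 / 2)"
      unfolding Bochner_Integration.integral_add[OF mgf1(1)[OF that, of 1] mgf1(1)[OF that, of "- 1"]]
      using mgf1(2)[OF that, of 1] mgf1(2)[OF that, of "- 1"] by simp
    also have "\<dots> \<le> 4"
      using exp_bound_half[of "1/2::real"] by simp
    finally show ?thesis .
  qed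
  then have "(\<Sum>k\<in>K. expectation (\<lambda>\<omega>. \<bar>Z k \<omega>\<bar>)) \<le> (\<Sum>k\<in>K. 4)"
    by (rule sum_mono)
  then have E: "expectation (\<lambda>\<omega>. \<Sum>k\<in>K. \<bar>Z k \<omega>\<bar>) \<le> 4 * card K"
    using i by (simp add: Bochner_Integration.integral_sum)
  have "prob {\<omega> \<in> space M. (\<Sum>k\<in>K. \<bar>Z k \<omega>\<bar>) \<ge> 16 * card K} \<le> expectation (\<lambda>\<omega>. \<Sum>k\<in>K. \<bar>Z k \<omega>\<bar>) / (16 * card K)"
    using K i by (intro integral_Markov_inequality_measure[where A = "{}"]) (auto simp: sum_nonneg card_gt_0_iff)
  also have "\<dots> \<le> (4 * card K) / (16 * card K)"
    using E by (intro divide_right_mono) auto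
  also have "\<dots> = 1 / 4" using K by simp
  finally show ?thesis .
qed

text \<open>Both properties must hold on one event: the bound on the sum ensures that the level is
  kept, and the large maximum makes keeping it expensive. The probability left is 3 / 4 minus 1 /
  4.\<close>

lemma (in prob_space) max_ge_sum_abs_le_of_mgf:
  fixes Z :: "'i \<Rightarrow> 'a \<Rightarrow> real"
  assumes K: "finite K" "card K \<ge> 256"
    and Zm: "\<And>k. k \<in> K \<Longrightarrow> Z k \<in> borel_measurable M"
    and mgf1: "\<And>k l. k \<in> K \<Longrightarrow> integrable M (\<lambda>\<omega>. exp (l * Z k \<omega>))"
      "\<And>k l. k \<in> K \<Longrightarrow> expectation (\<lambda>\<omega>. exp (l * Z k \<omega>)) = exp (l\<^sup>2 / 2)"
    and mgf2: "\<And>k k' l. k \<in> K \<Longrightarrow> k' \<in> K \<Longrightarrow> k \<noteq> k' \<Longrightarrow> integrable M (\<lambda>\<omega>. exp (l * (Z k \<omega> + Z k' \<omega>)))"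
      "\<And>k k' l. k \<in> K \<Longrightarrow> k' \<in> K \<Longrightarrow> k \<noteq> k' \<Longrightarrow> expectation (\<lambda>\<omega>. exp (l * (Z k \<omega> + Z k' \<omega>))) = exp (l\<^sup>2)"
  shows "\<exists>E\<in>sets M. prob E \<ge> 1 / 2 \<and>
    (\<forall>\<omega>\<in>E. (\<exists>k\<in>K. Z k \<omega> \<ge> sqrt (ln (card K) / 2) / 4) \<and> (\<Sum>k\<in>K. \<bar>Z k \<omega>\<bar>) \<le> 16 * card K)"
proof -
  let ?A = "{\<omega> \<in> space M. \<exists>k\<in>K. Z k \<omega> \<ge> sqrt (ln (card K) / 2) / 4}"
  let ?B = "{\<omega> \<in> space M. (\<Sum>k\<in>K. \<bar>Z k \<omega>\<bar>) \<ge> 16 * card K}"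
  have A: "?A \<in> sets M" using Zm K by measurable
  have B: "?B \<in> sets M" using Zm by measurable
  have "prob ?A \<le> prob (?A - ?B) + prob ?B"
    using A B finite_measure_mono[of ?A "(?A - ?B) \<union> ?B"] measure_Un_le[of "?A - ?B" M ?B] by auto
  moreover have "prob ?A \<ge> 3 / 4"
    by (rule max_ge_of_mgf[OF assms])
  moreover have "prob ?B \<le> 1 / 4"
    using K by (intro sum_abs_le_of_mgf Zm mgf1) auto
  ultimately have "prob (?A - ?B) \<ge> 1 / 2" by simp
  with A B show ?thesis by (intro bexI[of _ "?A - ?B"]) auto
qed

subsection \<open>Wavelet sums and the sup-norm\<close>

text \<open>For edge wavelets bounded support is not postulated; it follows from their
  representation by a finite filter.\<close>

lemma compactly_supported_filter:
  assumes "compactly_supported \<phi>" "finite F"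
    and e: "\<And>x. x \<in> H \<Longrightarrow> e x = (\<Sum>m\<in>F. h m * \<phi> (2 * x - of_int m))"
  shows "\<exists>R. \<forall>x\<in>H. \<bar>x\<bar> > R \<longrightarrow> e x = (0::real)"
proof -
  obtain R where R: "\<And>x. \<bar>x\<bar> > R \<Longrightarrow> \<phi> x = 0"
    using assms(1) by (auto simp: compactly_supported_def)
  have "e x = 0" if "x \<in> H" "\<bar>x\<bar> > \<bar>R\<bar> + (\<Sum>m\<in>F. \<bar>real_of_int m\<bar>)" for x
  proof -
    have "\<phi> (2 * x - of_int m) = 0" if "m \<in> F" for m
    proof (rule R)
      have "\<bar>real_of_int m\<bar> \<le> (\<Sum>m\<in>F. \<bar>real_of_int m\<bar>)"
        using \<open>finite F\<close> that by (intro member_le_sum) auto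
      then show "R < \<bar>2 * x - of_int m\<bar>"
        using \<open>\<bar>x\<bar> > _\<close> by linarith
    qed
    then show ?thesis using e[OF that(1)] by simp
  qed
  then show ?thesis by blast
qed

lemma uniform_radius:
  fixes e :: "nat \<Rightarrow> real \<Rightarrow> real"
  assumes "\<And>l. l < N \<Longrightarrow> \<exists>R. \<forall>x\<in>H. \<bar>x\<bar> > R \<longrightarrow> e l x = 0"
  shows "\<exists>R. \<forall>l<N. \<forall>x\<in>H. \<bar>x\<bar> > R \<longrightarrow> e l x = 0"
proof -
  obtain R where R: "\<And>l x. l < N \<Longrightarrow> x \<in> H \<Longrightarrow> \<bar>x\<bar> > R l \<Longrightarrow> e l x = 0"
    using assms by metis
  have "R l \<le> (\<Sum>l<N. \<bar>R l\<bar>)" if "l < N" for l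
    using member_le_sum[of l "{..<N}" "\<lambda>l. \<bar>R l\<bar>"] that by auto
  then have "\<forall>l<N. \<forall>x\<in>H. \<bar>x\<bar> > (\<Sum>l<N. \<bar>R l\<bar>) \<longrightarrow> e l x = 0"
    using R by (meson order_le_less_trans)
  then show ?thesis by blast
qed

lemma scaled_support:
  fixes x c p R :: real
  assumes "p > 0" "\<bar>p * (x - c)\<bar> \<le> R"
  shows "x \<in> {c - R / p..c - R / p + 2 * R / p}"
proof -
  have "\<bar>x - c\<bar> \<le> R / p"
    using assms by (simp add: abs_mult pos_le_divide_eq mult.commute)
  moreover have "2 * R / p = R / p + R / p" by simp
  ultimately show ?thesis
    unfolding atLeastAtMost_iff by linarith
qed

text \<open>Interior functions are centred at k / 2^j, the two kinds of edge functions at 0 and at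
  1. There are finitely many edge functions, hence one radius for all. Below \<open>j0\<close> the
  basis may contain arbitrary elements of a fixed approximation space, so the claim starts at
  \<open>j0\<close>.\<close>

lemma wavelet_basis_support:
  assumes "wavelet_basis s N \<phi> \<psi> I \<Psi>"
  obtains R j1 where "R > 0" "j1 \<ge> 0"
    "\<And>j k. j \<ge> j1 \<Longrightarrow> k \<in> I j \<Longrightarrow>
       \<exists>c. \<forall>x\<in>{0..1}. x \<notin> {c..c + R * 2 powr (- of_int j)} \<longrightarrow> \<Psi> j k x = 0"
proof -
  have sw: "scaling_wavelet_pair s N \<phi> \<psi>"
    using assms by (simp add: wavelet_basis_def)
  then have cs: "compactly_supported \<phi>" "compactly_supported \<psi>"
    by (auto simp: scaling_wavelet_pair_def)
  obtain j0 eL eR where j0: "j0 \<ge> 0" and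
    edge: "\<forall>l<N. edge_wavelet \<phi> N {0..} (eL l) \<and> edge_wavelet \<phi> N {..0} (eR l)" and
    cases: "\<forall>j\<ge>-1. \<forall>k\<in>I j.
           interior_wavelet \<phi> \<psi> j k (\<Psi> j k) \<or>
           (j0 \<le> j \<and> (\<exists>l<N. \<forall>x\<in>{0..1}.
              \<Psi> j k x = 2 powr (of_int j / 2) * eL l (2 powr of_int j * x))) \<or>
           (j0 \<le> j \<and> (\<exists>l<N. \<forall>x\<in>{0..1}.
              \<Psi> j k x = 2 powr (of_int j / 2) * eR l (2 powr of_int j * (x - 1)))) \<or>
           (j < j0 \<and> (\<exists>F h. finite F \<and> (\<forall>x\<in>{0..1}.
              \<Psi> j k x = (\<Sum>m\<in>F. h m * \<phi> (2 powr of_int j0 * x - of_int m)))))"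
    using assms unfolding wavelet_basis_def by blast
  obtain R1 where R1: "\<And>x. \<bar>x\<bar> > R1 \<Longrightarrow> \<psi> x = 0"
    using cs(2) by (auto simp: compactly_supported_def)
  have supp: "\<exists>R. \<forall>x\<in>H. \<bar>x\<bar> > R \<longrightarrow> e x = 0" if "edge_wavelet \<phi> N H e" for H e
    using that compactly_supported_filter[OF cs(1), of _ H e] unfolding edge_wavelet_def by blast
  have "\<exists>R. \<forall>l<N. \<forall>x\<in>{0..}. \<bar>x\<bar> > R \<longrightarrow> eL l x = 0"
    by (rule uniform_radius) (use supp edge in blast)
  then obtain R2 where R2: "\<And>l x. l < N \<Longrightarrow> x \<ge> 0 \<Longrightarrow> \<bar>x\<bar> > R2 \<Longrightarrow> eL l x = 0"
    by auto
  have "\<exists>R. \<forall>l<N. \<forall>x\<in>{..0}. \<bar>x\<bar> > R \<longrightarrow> eR l x = 0"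
    by (rule uniform_radius) (use supp edge in blast)
  then obtain R3 where R3: "\<And>l x. l < N \<Longrightarrow> x \<le> 0 \<Longrightarrow> \<bar>x\<bar> > R3 \<Longrightarrow> eR l x = 0"
    by auto
  define R where "R = 1 + \<bar>R1\<bar> + \<bar>R2\<bar> + \<bar>R3\<bar>"
  have Rle: "R1 \<le> R" "R2 \<le> R" "R3 \<le> R" and "R > 0"
    by (auto simp: R_def)
  show thesis
  proof (rule that[of "2 * R" j0])
    show "2 * R > 0" "j0 \<ge> 0" using \<open>R > 0\<close> j0 by auto
    fix j k assume jk: "j \<ge> j0" "k \<in> I j"
    define p :: real where "p = 2 powr of_int j"
    have p: "p > 0" by (simp add: p_def)
    have pinv: "2 * R * 2 powr (- of_int j) = 2 * R / p"
      by (simp add: p_def powr_minus divide_inverse)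
    have main: "\<exists>c. \<forall>x\<in>{0..1}. x \<notin> {c..c + 2 * R / p} \<longrightarrow> \<Psi> j k x = 0"
      if "\<And>x. x \<in> {0..1} \<Longrightarrow> \<bar>p * (x - c)\<bar> > R \<Longrightarrow> \<Psi> j k x = 0" for c
      using that scaled_support[OF p, of _ c R] by (intro exI[of _ "c - R / p"]) (meson not_le)
    have "j \<ge> -1" "j \<noteq> -1" "\<not> j < j0" using jk j0 by auto
    with cases jk consider
        "interior_wavelet \<phi> \<psi> j k (\<Psi> j k)"
      | "\<exists>l<N. \<forall>x\<in>{0..1}. \<Psi> j k x = 2 powr (of_int j / 2) * eL l (p * x)"
      | "\<exists>l<N. \<forall>x\<in>{0..1}. \<Psi> j k x = 2 powr (of_int j / 2) * eR l (p * (x - 1))"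
      unfolding p_def by blast
    then show "\<exists>c. \<forall>x\<in>{0..1}. x \<notin> {c..c + 2 * R * 2 powr (- of_int j)} \<longrightarrow> \<Psi> j k x = 0"
      unfolding pinv
    proof cases
      case 1
      show "\<exists>c. \<forall>x\<in>{0..1}. x \<notin> {c..c + 2 * R / p} \<longrightarrow> \<Psi> j k x = 0"
      proof (rule main)
        fix x assume x: "x \<in> {0..1::real}" "\<bar>p * (x - of_int k / p)\<bar> > R"
        then have "\<bar>p * x - of_int k\<bar> > R1"
          using p Rle by (simp add: right_diff_distrib)
        then show "\<Psi> j k x = 0"
          using 1 x(1) R1 \<open>j \<noteq> -1\<close> by (simp add: interior_wavelet_def wav_def p_def)
      qed
    next
      case 2
      then obtain l where l: "l < N" "\<And>x. x \<in> {0..1} \<Longrightarrow> \<Psi> j k x = 2 powr (of_int j / 2) * eL l (p * x)"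
        by blast
      show "\<exists>c. \<forall>x\<in>{0..1}. x \<notin> {c..c + 2 * R / p} \<longrightarrow> \<Psi> j k x = 0"
      proof (rule main)
        fix x assume x: "x \<in> {0..1::real}" "\<bar>p * (x - 0)\<bar> > R"
        have "eL l (p * x) = 0"
          using x Rle p l(1) by (intro R2) auto
        then show "\<Psi> j k x = 0" using l(2)[OF x(1)] by simp
      qed
    next
      case 3
      then obtain l where l: "l < N" "\<And>x. x \<in> {0..1} \<Longrightarrow> \<Psi> j k x = 2 powr (of_int j / 2) * eR l (p * (x - 1))"
        by blast
      show "\<exists>c. \<forall>x\<in>{0..1}. x \<notin> {c..c + 2 * R / p} \<longrightarrow> \<Psi> j k x = 0"
      proof (rule main)
        fix x assume x: "x \<in> {0..1::real}" "\<bar>p * (x - 1)\<bar> > R"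
        have "eR l (p * (x - 1)) = 0"
          using x Rle p l(1) by (intro R3 mult_nonneg_nonpos) auto
        then show "\<Psi> j k x = 0" using l(2)[OF x(1)] by simp
      qed
    qed
  qed
qed

text \<open>Cauchy-Schwarz against the indicator of the support. Only the unit L2-norm enters, so
  interior and edge functions are treated alike.\<close>

lemma integral_abs_le_of_support:
  assumes g: "g \<in> L2 (lebesgue_on {0..1})" and g1: "(\<integral>x. (g x)\<^sup>2 \<partial>lebesgue_on {0..1}) = 1"
    and "b \<ge> 0" and supp: "\<And>x. x \<in> {0..1} \<Longrightarrow> x \<notin> {c..c + b} \<Longrightarrow> g x = 0"
  shows "(\<integral>x. \<bar>g x\<bar> \<partial>lebesgue_on {0..1}) \<le> sqrt b"
proof -
  let ?\<mu> = "lebesgue_on {0..1::real}"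
  let ?i = "indicator {c..c + b} :: real \<Rightarrow> real"
  have sq: "(?i x)\<^sup>2 = ?i x" for x by (simp add: indicator_def)
  have em: "emeasure ?\<mu> ({0..1} \<inter> {c..c + b}) \<le> ennreal b"
    using \<open>b \<ge> 0\<close> emeasure_mono[of "{0..1} \<inter> {c..c + b}" "{c..c + b}" lebesgue]
    by (subst emeasure_restrict_space) auto
  have set: "{0..1} \<inter> {c..c + b} \<in> sets ?\<mu>"
    by (subst sets_restrict_space_iff) auto
  have "integrable ?\<mu> (indicator ({0..1} \<inter> {c..c + b}) :: real \<Rightarrow> real)"
    using em by (intro integrable_real_indicator set) (auto simp: top_unique less_top[symmetric])
  moreover have "integrable ?\<mu> (indicator ({0..1} \<inter> {c..c + b}) :: real \<Rightarrow> real) \<longleftrightarrow> integrable ?\<mu> ?i"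
    by (rule Bochner_Integration.integrable_cong) (auto simp: indicator_def)
  ultimately have int: "integrable ?\<mu> ?i" by simp
  then have iL2: "?i \<in> L2 ?\<mu>"
    by (simp only: L2_def sq mem_Collect_eq borel_measurable_integrable)
  have "(\<integral>x. (?i x)\<^sup>2 \<partial>?\<mu>) = (\<integral>x. indicator ({0..1} \<inter> {c..c + b}) x \<partial>?\<mu>)"
    unfolding sq by (rule Bochner_Integration.integral_cong) (auto simp: indicator_def)
  also have "\<dots> = measure ?\<mu> ({0..1} \<inter> {c..c + b})"
    by (simp add: Int_commute Int_left_absorb)
  also have "\<dots> \<le> b"
    using em \<open>b \<ge> 0\<close> unfolding measure_def by (intro enn2real_leI) auto
  finally have i: "(\<integral>x. (?i x)\<^sup>2 \<partial>?\<mu>) \<le> b" .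
  have "(\<integral>x. \<bar>g x\<bar> \<partial>?\<mu>) = (\<integral>x. \<bar>g x * ?i x\<bar> \<partial>?\<mu>)"
    using supp by (intro Bochner_Integration.integral_cong) (auto simp: indicator_def)
  also have "\<dots> \<le> sqrt b"
    using L2_Cauchy_Schwarz[OF g iL2] i g1 by (intro real_le_rsqrt) simp
  finally show ?thesis .
qed

text \<open>Hoelder's inequality, stated in \<open>ennreal\<close> because the essential supremum of
  an L2 function may be infinite. It turns the error of a single coefficient into a lower bound for
  the sup-norm loss.\<close>

lemma sup_norm_duality:
  assumes u: "u \<in> L2 (lebesgue_on {0..1})" and g: "g \<in> L2 (lebesgue_on {0..1})"
  shows "ennreal \<bar>\<integral>x. u x * g x \<partial>lebesgue_on {0..1}\<bar> \<le>
    sup_norm u * ennreal (\<integral>x. \<bar>g x\<bar> \<partial>lebesgue_on {0..1})"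
proof -
  let ?\<mu> = "lebesgue_on {0..1::real}"
  note [measurable] = u[THEN L2_measurable] g[THEN L2_measurable]
  have ug: "integrable ?\<mu> (\<lambda>x. \<bar>u x * g x\<bar>)"
    using L2_mult_integrable[OF u g] by simp
  have "ennreal \<bar>\<integral>x. u x * g x \<partial>?\<mu>\<bar> \<le> ennreal (\<integral>x. \<bar>u x * g x\<bar> \<partial>?\<mu>)"
    by (intro ennreal_leI integral_abs_bound)
  also have "\<dots> = (\<integral>\<^sup>+x. ennreal \<bar>u x\<bar> * ennreal \<bar>g x\<bar> \<partial>?\<mu>)"
    using nn_integral_eq_integral[OF ug] by (simp add: abs_mult ennreal_mult)
  also have "\<dots> \<le> (\<integral>\<^sup>+x. sup_norm u * ennreal \<bar>g x\<bar> \<partial>?\<mu>)"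
  proof (rule nn_integral_mono_AE)
    have "AE x in ?\<mu>. ennreal \<bar>u x\<bar> \<le> sup_norm u"
      unfolding sup_norm_def by (rule esssup_AE)
    then show "AE x in ?\<mu>. ennreal \<bar>u x\<bar> * ennreal \<bar>g x\<bar> \<le> sup_norm u * ennreal \<bar>g x\<bar>"
      by eventually_elim (rule mult_right_mono, auto)
  qed
  also have "\<dots> = sup_norm u * (\<integral>\<^sup>+x. ennreal \<bar>g x\<bar> \<partial>?\<mu>)"
    by (rule nn_integral_cmult) measurable
  also have "(\<integral>\<^sup>+x. ennreal \<bar>g x\<bar> \<partial>?\<mu>) = ennreal (\<integral>x. \<bar>g x\<bar> \<partial>?\<mu>)"
    using L2_unit_integrable[OF g] by (intro nn_integral_eq_integral) auto
  finally show ?thesis .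
qed

lemma wavelet_sum_L2:
  assumes "orthonormal_basis \<mu> (Sigma {-1..} I) (\<lambda>(j, k). \<Psi> j k)" "A \<subseteq> {-1..}"
  shows "(\<lambda>x. \<Sum>j\<in>A. \<Sum>k\<in>I j. b j k * \<Psi> j k x) \<in> L2 \<mu>"
  using assms by (intro L2_sum L2_cmult) (auto simp: orthonormal_basis_def)

lemma wavelet_sum_coeff:
  fixes I :: "int \<Rightarrow> int set"
  assumes ob: "orthonormal_basis \<mu> (Sigma {-1..} I) (\<lambda>(j, k). \<Psi> j k)" and A: "A \<subseteq> {-1..}" "finite A"
    and fin: "\<And>j. j \<ge> -1 \<Longrightarrow> finite (I j)" and jk: "j' \<ge> -1" "k' \<in> I j'"
  shows "(\<integral>x. (\<Sum>j\<in>A. \<Sum>k\<in>I j. b j k * \<Psi> j k x) * \<Psi> j' k' x \<partial>\<mu>) = (if j' \<in> A then b j' k' else 0)"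
proof -
  have L2: "\<Psi> j k \<in> L2 \<mu>" if "j \<ge> -1" "k \<in> I j" for j k
    using ob that by (auto simp: orthonormal_basis_def)
  have orth: "(\<integral>x. \<Psi> j k x * \<Psi> j' k' x \<partial>\<mu>) = (if (j, k) = (j', k') then 1 else 0)" if "j \<ge> -1" "k \<in> I j" for j k
    using ob that jk unfolding orthonormal_basis_def by (auto simp: Ball_def split: prod.splits)
  have int: "integrable \<mu> (\<lambda>x. b j k * (\<Psi> j k x * \<Psi> j' k' x))" if "j \<in> A" "k \<in> I j" for j k
    using that A jk by (intro integrable_mult_right L2_mult_integrable L2) auto
  have "(\<integral>x. (\<Sum>j\<in>A. \<Sum>k\<in>I j. b j k * \<Psi> j k x) * \<Psi> j' k' x \<partial>\<mu>) =
      (\<integral>x. (\<Sum>j\<in>A. \<Sum>k\<in>I j. b j k * (\<Psi> j k x * \<Psi> j' k' x)) \<partial>\<mu>)"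
    by (simp only: sum_distrib_right mult.assoc)
  also have "\<dots> = (\<Sum>j\<in>A. \<integral>x. (\<Sum>k\<in>I j. b j k * (\<Psi> j k x * \<Psi> j' k' x)) \<partial>\<mu>)"
    by (intro Bochner_Integration.integral_sum Bochner_Integration.integrable_sum int)
  also have "\<dots> = (\<Sum>j\<in>A. \<Sum>k\<in>I j. \<integral>x. b j k * (\<Psi> j k x * \<Psi> j' k' x) \<partial>\<mu>)"
    by (intro sum.cong refl Bochner_Integration.integral_sum int)
  also have "\<dots> = (\<Sum>j\<in>A. if j = j' then b j' k' else 0)"
  proof (intro sum.cong refl)
    fix j assume "j \<in> A"
    then have j: "j \<ge> -1" using A by auto
    have "(\<Sum>k\<in>I j. \<integral>x. b j k * (\<Psi> j k x * \<Psi> j' k' x) \<partial>\<mu>) = (\<Sum>k\<in>I j. b j k * (if (j, k) = (j', k') then 1 else 0))"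
      using orth[OF j] by (intro sum.cong refl) (simp only: integral_mult_right_zero)
    also have "\<dots> = (\<Sum>k\<in>I j. if k = k' then (if j = j' then b j' k' else 0) else 0)"
      by (intro sum.cong) auto
    also have "\<dots> = (if j = j' then b j' k' else 0)"
      using fin[OF j] jk by auto
    finally show "(\<Sum>k\<in>I j. \<integral>x. b j k * (\<Psi> j k x * \<Psi> j' k' x) \<partial>\<mu>) = (if j = j' then b j' k' else 0)" .
  qed
  also have "\<dots> = (if j' \<in> A then b j' k' else 0)"
    using A by simp
  finally show ?thesis .
qed

subsection \<open>The data-driven levels\<close>

text \<open>\<open>J0\<close> is a \<open>LEAST\<close> over the integers, which are not
  well-ordered. The side condition -1 \<le> j permits a shift by 1 to the natural numbers, where the
  minimum exists.\<close>

lemma J0_le: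
  assumes "j \<ge> -1" "real (card (I j)) > real n powr (1 / ln (ln (real n)))"
  shows "-1 \<le> J0 I n" "J0 I n \<le> j"
proof -
  define P where "P = (\<lambda>j. -1 \<le> j \<and> real (card (I j)) > real n powr (1 / ln (ln (real n))))"
  define i where "i = (LEAST i::nat. P (int i - 1))"
  have "P (int (nat (j + 1)) - 1)" using assms by (simp add: P_def)
  then have Pi: "P (int i - 1)" and le: "i \<le> nat (j + 1)"
    unfolding i_def by (rule LeastI, rule Least_le)
  have min: "int i - 1 \<le> j'" if "P j'" for j'
  proof -
    have "P (int (nat (j' + 1)) - 1)" using that by (simp add: P_def)
    then have "i \<le> nat (j' + 1)" unfolding i_def by (rule Least_le)
    moreover have "j' \<ge> -1" using that by (simp add: P_def)
    ultimately show ?thesis by linarith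
  qed
  have "J0 I n = int i - 1"
    unfolding J0_def P_def[symmetric] using Pi min by (rule Least_equality)
  then show "-1 \<le> J0 I n" "J0 I n \<le> j"
    using le assms(1) by auto
qed

lemma finite_Pset: "finite (Pset n)"
proof (rule finite_subset)
  show "Pset n \<subseteq> {..nat \<lfloor>ln (real n) / (ln (ln (real n)))\<^sup>2\<rfloor>}"
    by (auto simp: Pset_def intro!: le_nat_floor)
qed simp

lemma Kconst_1: "Kconst 1 > 0"
  by (simp add: Kconst_def add_pos_pos)

text \<open>The exponent \<open>p = 1\<close> alone keeps a level on which the mean absolute coefficient is of
  order \<open>1 / sqrt n\<close>, without any logarithmic factor.\<close>

lemma tlevel_pos:
  assumes n: "n \<ge> 1" "1 \<in> Pset n" and I: "finite (I j)" "I j \<noteq> {}"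
    and y: "(\<Sum>k\<in>I j. \<bar>y j k\<bar>) \<ge> 2 * Kconst 1 * real (card (I j)) / sqrt (real n)"
  shows "tlevel I n y j > 0"
proof -
  define D where "D = Dset I n y j 1"
  have powr: "real n powr (- (1 / 2)) = 1 / sqrt (real n)"
    using n by (simp only: powr_minus powr_half_sqrt of_nat_0_le_iff inverse_eq_divide)
  have "I j \<in> D"
    using y unfolding D_def Dset_def by (simp add: powr)
  have "D \<subseteq> Pow (I j)" by (auto simp: D_def Dset_def)
  then have "finite D" using I by (simp add: finite_subset)
  \<comment> \<open>The threshold is positive, so the empty sum does not reach it. Hence
    \<open>Lmin\<close> is at least 1, and the denominator \<open>Lmin - 1\<close> is positive
    outside the case that has its own clause.\<close>
  have "{} \<notin> D"
    using n I Kconst_1 by (auto simp: D_def Dset_def powr not_le card_gt_0_iff)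
  have "Lmin I n y j 1 \<in> card ` D"
    unfolding Lmin_def D_def[symmetric] using \<open>finite D\<close> \<open>I j \<in> D\<close> by (intro Min_in) auto
  then obtain S where S: "S \<in> D" "Lmin I n y j 1 = card S" by auto
  have "S \<subseteq> I j" using S \<open>D \<subseteq> Pow (I j)\<close> by auto
  then have "finite S" "S \<noteq> {}"
    using S \<open>{} \<notin> D\<close> finite_subset[OF _ I(1)] by auto
  then have L: "Lmin I n y j 1 \<ge> 1" using S by (simp add: Suc_le_eq card_gt_0_iff)
  have "tlevel_p I n y j 1 > 0"
  proof (cases "Lmin I n y j 1 = 1")
    case True
    then show ?thesis using \<open>I j \<in> D\<close> by (auto simp: tlevel_p_def D_def)
  next
    case False
    with L have "real (Lmin I n y j 1) - 1 > 0" by simp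
    moreover have "Kconst 1 * real (card (I j)) > 0"
      using I Kconst_1 by (simp add: card_gt_0_iff)
    ultimately show ?thesis
      using n \<open>I j \<in> D\<close> False by (auto simp: tlevel_p_def D_def intro!: divide_pos_pos)
  qed
  also have "tlevel_p I n y j 1 \<le> Max (tlevel_p I n y j ` Pset n)"
    using n finite_Pset by (intro Max_ge) auto
  \<comment> \<open>If a large coefficient triggers the first clause of \<open>tlevel\<close>, the
    value is infinite and the claim holds as well.\<close>
  finally show ?thesis by (simp add: tlevel_def)
qed

subsection \<open>The lower bound\<close>

text \<open>The loss is tested against the wavelet with the extreme coefficient. The link between
  the level and \<beta> is \<open>signal\<close>: coefficients large enough to be detected are still
  admissible at level \<open>j\<close>.\<close>

lemma risk_lower_bound_at_level:
  fixes M :: "'w measure" and I :: "int \<Rightarrow> int set"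
  assumes wb: "wavelet_basis s N \<phi> \<psi> I \<Psi>" and W: "brownian_motion M W"
    and Y: "\<And>f k. f \<in> L2 (lebesgue_on {0..1}) \<Longrightarrow> k \<in> I j \<Longrightarrow>
           is_stochastic_integral M (observation W n f) (\<Psi> j k) (Y n f j k)"
    and n: "n \<ge> 1" "1 \<in> Pset n" and j: "-1 \<le> J0 I n" "J0 I n < j" "j \<le> J n"
    and card: "card (I j) \<ge> 256" and "Q > 0"
    and signal: "(2 * Kconst 1 + 16) / sqrt (real n) \<le> Q * 2 powr (- (of_int j / 2) * (2 * \<beta> + 1))"
    and "R > 0"
    and supp: "\<And>k. k \<in> I j \<Longrightarrow> \<exists>c. \<forall>x\<in>{0..1}. x \<notin> {c..c + R * 2 powr (- of_int j)} \<longrightarrow> \<Psi> j k x = 0"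
  shows "\<exists>f\<in>Theta I \<Psi> \<beta> Q. risk M I \<Psi> J Y n f \<ge>
    ennreal (sqrt (ln (card (I j)) / 2) / (8 * sqrt (real n) * sqrt (R * 2 powr (- of_int j))))"
proof -
  let ?\<mu> = "lebesgue_on {0..1::real}"
  interpret prob_space M using W by (simp add: brownian_motion_def)
  have ob: "orthonormal_basis ?\<mu> (Sigma {-1..} I) (\<lambda>(j, k). \<Psi> j k)" and fin: "\<And>j. j \<ge> -1 \<Longrightarrow> finite (I j)"
    using wb by (auto simp: wavelet_basis_def)
  have j1: "j \<ge> -1" using j by simp
  have \<Psi>L2: "\<Psi> j k \<in> L2 ?\<mu>" if "k \<in> I j" for k
    using ob that j1 by (auto simp: orthonormal_basis_def)
  have \<Psi>orth: "(\<integral>x. \<Psi> j k x * \<Psi> j k' x \<partial>?\<mu>) = (if k = k' then 1 else 0)" if "k \<in> I j" "k' \<in> I j" for k k'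
    using ob that j1 unfolding orthonormal_basis_def by (auto simp: Ball_def split: prod.splits)
  \<comment> \<open>On the good event the mean absolute noise is at most 16 / sqrt n, so at least 2
    K_1 / sqrt n remains on average, which is the threshold of \<open>Dset\<close> for p =
    1.\<close>
  define d where "d = (2 * Kconst 1 + 16) / sqrt (real n)"
  have "d > 0" using n Kconst_1 by (simp add: d_def)
  define f where "f = (\<lambda>x. \<Sum>i\<in>{j}. \<Sum>k\<in>I i. d * \<Psi> i k x)"
  have fL2: "f \<in> L2 ?\<mu>"
    unfolding f_def using j1 by (intro wavelet_sum_L2[OF ob]) auto
  have coeff: "wcoeff \<Psi> f i k = (if i = j then d else 0)" if "i \<ge> -1" "k \<in> I i" for i k
    unfolding wcoeff_def f_def
    using wavelet_sum_coeff[OF ob _ _ fin that, of "{j}" "\<lambda>_ _. d"] j1 by simp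
  have fTheta: "f \<in> Theta I \<Psi> \<beta> Q"
  proof -
    have "f x - (\<Sum>i\<in>{-1..int m}. \<Sum>k\<in>I i. wcoeff \<Psi> f i k * \<Psi> i k x) = 0" if "m \<ge> nat j" for m x
    proof -
      have "(\<Sum>i\<in>{-1..int m}. \<Sum>k\<in>I i. wcoeff \<Psi> f i k * \<Psi> i k x) =
          (\<Sum>i\<in>{-1..int m}. if i = j then (\<Sum>k\<in>I i. d * \<Psi> i k x) else 0)"
        using coeff by (intro sum.cong) auto
      also have "\<dots> = f x" using that j1 by (simp add: f_def)
      finally show ?thesis by simp
    qed
    then have "eventually (\<lambda>m. (\<integral>x. (f x - (\<Sum>i\<in>{-1..int m}. \<Sum>k\<in>I i. wcoeff \<Psi> f i k * \<Psi> i k x))\<^sup>2 \<partial>?\<mu>) = 0) sequentially"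
      by (intro eventually_sequentiallyI[of "nat j"]) simp
    then have "(\<lambda>m::nat. \<integral>x. (f x - (\<Sum>i\<in>{-1..int m}. \<Sum>k\<in>I i. wcoeff \<Psi> f i k * \<Psi> i k x))\<^sup>2 \<partial>?\<mu>) \<longlonglongrightarrow> 0"
      by (rule tendsto_eventually)
    moreover have "\<bar>wcoeff \<Psi> f i k\<bar> \<le> Q * 2 powr (- (of_int i / 2) * (2 * \<beta> + 1))" if "i \<ge> -1" "k \<in> I i" for i k
      using coeff[OF that] signal \<open>d > 0\<close> \<open>Q > 0\<close> by (auto simp: d_def)
    ultimately show ?thesis
      using fL2 by (simp add: Theta_def)
  qed
  have fcoeff: "(\<integral>x. f x * \<Psi> j k x \<partial>?\<mu>) = d" if "k \<in> I j" for k
    using coeff[OF j1 that] by (simp add: wcoeff_def)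
  define Z where "Z = (\<lambda>k \<omega>. sqrt (real n) * (Y n f j k \<omega> - d))"
  have Ym[measurable]: "Y n f j k \<in> borel_measurable M" if "k \<in> I j" for k
    using Y[OF fL2 that] by (simp add: is_stochastic_integral_def)
  have one: "integrable M (\<lambda>\<omega>. exp (l * Z k \<omega>))" "expectation (\<lambda>\<omega>. exp (l * Z k \<omega>)) = exp (l\<^sup>2 / 2)"
    if "k \<in> I j" for k l
    using stochastic_integral_mgf[OF W n(1) fL2 \<Psi>L2[OF that] Y[OF fL2 that], of 1 l]
      \<Psi>orth[OF that that] fcoeff[OF that] by (simp_all add: Z_def power2_eq_square[of "\<Psi> j k _"])
  have two: "integrable M (\<lambda>\<omega>. exp (l * (Z k \<omega> + Z k' \<omega>)))"
    "expectation (\<lambda>\<omega>. exp (l * (Z k \<omega> + Z k' \<omega>))) = exp (l\<^sup>2)"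
    if k: "k \<in> I j" "k' \<in> I j" "k \<noteq> k'" for k k' l
  proof -
    have obs: "observation W n f t \<in> borel_measurable M" if "t \<in> {0..1}" for t
    proof -
      have [measurable]: "W t \<in> borel_measurable M"
        using W that by (simp add: brownian_motion_def)
      have "observation W n f t = (\<lambda>\<omega>. (\<integral>u. f u \<partial>lebesgue_on {0..t}) + W t \<omega> / sqrt (real n))"
        by (simp add: fun_eq_iff observation_def)
      then show ?thesis by simp
    qed
    have X: "is_stochastic_integral M (observation W n f) (\<lambda>x. \<Psi> j k x + \<Psi> j k' x) (\<lambda>\<omega>. Y n f j k \<omega> + Y n f j k' \<omega>)"
      by (intro is_stochastic_integral_add Y fL2 k obs L2_measurable \<Psi>L2)
    have "(\<integral>x. (\<Psi> j k x + \<Psi> j k' x)\<^sup>2 \<partial>?\<mu>) =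
        (\<integral>x. \<Psi> j k x * \<Psi> j k x + \<Psi> j k' x * \<Psi> j k' x + 2 * (\<Psi> j k x * \<Psi> j k' x) \<partial>?\<mu>)"
      by (simp add: power2_sum power2_eq_square[of "\<Psi> j _ _"] mult.assoc)
    \<comment> \<open>Orthogonality removes the cross term, so the sum of two coefficients has the
      exponential moment exp(l^2) of variance 2.\<close>
    also have "\<dots> = 2"
      using k by (simp add: L2_mult_integrable \<Psi>L2 \<Psi>orth)
    finally have v: "(\<integral>x. (\<Psi> j k x + \<Psi> j k' x)\<^sup>2 \<partial>?\<mu>) = 2" .
    have c: "(\<integral>x. f x * (\<Psi> j k x + \<Psi> j k' x) \<partial>?\<mu>) = 2 * d"
      using k by (simp add: distrib_left L2_mult_integrable[OF fL2 \<Psi>L2] fcoeff)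
    have eq: "sqrt (real n) * (Y n f j k \<omega> + Y n f j k' \<omega> - 2 * d) = Z k \<omega> + Z k' \<omega>" for \<omega>
      by (simp add: Z_def algebra_simps)
    show "integrable M (\<lambda>\<omega>. exp (l * (Z k \<omega> + Z k' \<omega>)))"
      "expectation (\<lambda>\<omega>. exp (l * (Z k \<omega> + Z k' \<omega>))) = exp (l\<^sup>2)"
      using stochastic_integral_mgf[OF W n(1) fL2 L2_add[OF \<Psi>L2[OF k(1)] \<Psi>L2[OF k(2)]] X v, of l]
      unfolding c eq by simp_all
  qed
  obtain E where E: "E \<in> sets M" "prob E \<ge> 1 / 2"
    and max: "\<And>\<omega>. \<omega> \<in> E \<Longrightarrow> \<exists>k\<in>I j. Z k \<omega> \<ge> sqrt (ln (card (I j)) / 2) / 4"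
    and sum: "\<And>\<omega>. \<omega> \<in> E \<Longrightarrow> (\<Sum>k\<in>I j. \<bar>Z k \<omega>\<bar>) \<le> 16 * card (I j)"
  proof -
    have Zm: "Z k \<in> borel_measurable M" if "k \<in> I j" for k
      using Ym[OF that] unfolding Z_def by measurable
    have "\<exists>E\<in>sets M. prob E \<ge> 1 / 2 \<and> (\<forall>\<omega>\<in>E. (\<exists>k\<in>I j. Z k \<omega> \<ge> sqrt (ln (card (I j)) / 2) / 4) \<and>
        (\<Sum>k\<in>I j. \<bar>Z k \<omega>\<bar>) \<le> 16 * card (I j))"
      by (rule max_ge_sum_abs_le_of_mgf[OF fin[OF j1] card]) (fact Zm one two)+
    then obtain E where "E \<in> sets M" "prob E \<ge> 1 / 2"
      "\<forall>\<omega>\<in>E. (\<exists>k\<in>I j. Z k \<omega> \<ge> sqrt (ln (card (I j)) / 2) / 4) \<and> (\<Sum>k\<in>I j. \<bar>Z k \<omega>\<bar>) \<le> 16 * card (I j)"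
      by auto
    then show thesis
      by (intro that) auto
  qed
  define b where "b = sqrt (ln (card (I j)) / 2) / (4 * sqrt (real n))"
  define r where "r = sqrt (R * 2 powr (- of_int j))"
  have "r > 0" using \<open>R > 0\<close> by (simp add: r_def)
  have "b \<ge> 0" using card by (simp add: b_def)
  have loss: "ennreal (b / r) \<le> sup_norm (\<lambda>x. fhat1 I \<Psi> J n (\<lambda>j k. Y n f j k \<omega>) x - f x)" if \<omega>: "\<omega> \<in> E" for \<omega>
  proof -
    define y where "y = (\<lambda>j k. Y n f j k \<omega>)"
    have yZ: "y j k = d + Z k \<omega> / sqrt (real n)" for k
      using n by (simp add: y_def Z_def)
    have "2 * Kconst 1 * real (card (I j)) / sqrt (real n) = (\<Sum>k\<in>I j. d) - 16 * real (card (I j)) / sqrt (real n)"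
      by (simp add: d_def add_divide_distrib distrib_left mult.commute)
    also have "\<dots> \<le> (\<Sum>k\<in>I j. d) - (\<Sum>k\<in>I j. \<bar>Z k \<omega>\<bar>) / sqrt (real n)"
      using sum[OF \<omega>] by (intro diff_left_mono divide_right_mono) auto
    also have "\<dots> = (\<Sum>k\<in>I j. d - \<bar>Z k \<omega>\<bar> / sqrt (real n))"
      by (simp add: sum_subtractf sum_divide_distrib)
    also have "\<dots> \<le> (\<Sum>k\<in>I j. \<bar>y j k\<bar>)"
    proof (rule sum_mono)
      fix k
      have "\<bar>Z k \<omega> / sqrt (real n)\<bar> = \<bar>Z k \<omega>\<bar> / sqrt (real n)" by (simp add: abs_divide)
      then show "d - \<bar>Z k \<omega>\<bar> / sqrt (real n) \<le> \<bar>y j k\<bar>"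
        unfolding yZ by linarith
    qed
    finally have "tlevel I n y j > 0"
      using card by (intro tlevel_pos n fin[OF j1]) auto
    define u where "u = (\<lambda>x. fhat1 I \<Psi> J n y x - f x)"
    \<comment> \<open>Absorbing the keep-or-kill indicator into the coefficients makes
      \<open>fhat1\<close> a finite wavelet sum over two disjoint ranges of levels, so its
      coefficient on the kept level \<open>j\<close> is read off by orthonormality.\<close>
    have fh: "fhat1 I \<Psi> J n y = (\<lambda>x. (\<Sum>i\<in>{-1..J0 I n}. \<Sum>k\<in>I i. y i k * \<Psi> i k x) +
        (\<Sum>i\<in>{J0 I n + 1..J n}. \<Sum>k\<in>I i. (of_bool (tlevel I n y i > 0) * y i k) * \<Psi> i k x))"
      by (simp add: fun_eq_iff fhat1_def sum_distrib_left mult.assoc)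
    have A: "{-1..J0 I n} \<subseteq> {-1..}" "{J0 I n + 1..J n} \<subseteq> {-1..}"
      using j by auto
    note parts = wavelet_sum_L2[OF ob A(1)] wavelet_sum_L2[OF ob A(2)]
    have fhL2: "fhat1 I \<Psi> J n y \<in> L2 ?\<mu>"
      unfolding fh by (intro L2_add parts)
    have uL2: "u \<in> L2 ?\<mu>"
      unfolding u_def by (intro L2_diff fhL2 fL2)
    obtain k where k: "k \<in> I j" "Z k \<omega> \<ge> sqrt (ln (card (I j)) / 2) / 4"
      using max[OF \<omega>] by blast
    have "(\<integral>x. fhat1 I \<Psi> J n y x * \<Psi> j k x \<partial>?\<mu>) = y j k"
      unfolding fh distrib_right
      using wavelet_sum_coeff[OF ob A(1) _ fin j1 k(1)] wavelet_sum_coeff[OF ob A(2) _ fin j1 k(1)] j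
        \<open>tlevel I n y j > 0\<close> L2_mult_integrable[OF parts(1) \<Psi>L2[OF k(1)]] L2_mult_integrable[OF parts(2) \<Psi>L2[OF k(1)]]
      by simp
    then have uc: "(\<integral>x. u x * \<Psi> j k x \<partial>?\<mu>) = y j k - d"
      unfolding u_def left_diff_distrib using fcoeff[OF k(1)] k(1)
      by (simp add: L2_mult_integrable[OF fhL2 \<Psi>L2] L2_mult_integrable[OF fL2 \<Psi>L2])
    obtain c where c: "\<And>x. x \<in> {0..1} \<Longrightarrow> x \<notin> {c..c + R * 2 powr (- of_int j)} \<Longrightarrow> \<Psi> j k x = 0"
      using supp[OF k(1)] by blast
    have L1: "(\<integral>x. \<bar>\<Psi> j k x\<bar> \<partial>?\<mu>) \<le> r"
      unfolding r_def using \<open>R > 0\<close> \<Psi>orth[OF k(1) k(1)]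
      by (intro integral_abs_le_of_support[OF \<Psi>L2[OF k(1)] _ _ c]) (auto simp: power2_eq_square)
    have "b \<le> Z k \<omega> / sqrt (real n)"
      using divide_right_mono[OF k(2), of "sqrt (real n)"] by (simp add: b_def)
    also have "\<dots> \<le> \<bar>y j k - d\<bar>"
      by (simp add: yZ abs_divide divide_right_mono)
    finally have "ennreal b \<le> ennreal \<bar>\<integral>x. u x * \<Psi> j k x \<partial>?\<mu>\<bar>"
      unfolding uc by (rule ennreal_leI)
    also have "\<dots> \<le> sup_norm u * ennreal (\<integral>x. \<bar>\<Psi> j k x\<bar> \<partial>?\<mu>)"
      by (rule sup_norm_duality[OF uL2 \<Psi>L2[OF k(1)]])
    also have "\<dots> \<le> sup_norm u * ennreal r"
      by (intro mult_left_mono ennreal_leI L1) simp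
    finally have le: "ennreal b \<le> sup_norm u * ennreal r" .
    have "ennreal (b / r) \<le> sup_norm u"
    proof (cases "sup_norm u")
      case (real q)
      then have "b \<le> q * r"
        using le \<open>r > 0\<close> by (simp add: ennreal_mult[symmetric])
      then show ?thesis
        using real \<open>r > 0\<close> by (simp add: pos_divide_le_eq ennreal_leI)
    qed simp
    then show ?thesis by (simp add: u_def y_def)
  qed
  \<comment> \<open>The loss dominates b / r times the indicator of \<open>E\<close>, and
    monotonicity of the nonnegative integral needs no measurability of the loss in the outcome. The
    probability 1 / 2 turns the 4 in \<open>b\<close> into 8.\<close>
  have "ennreal (b / r * (1 / 2)) \<le> ennreal (b / r) * emeasure M E"
  proof -
    have "b / r * (1 / 2) \<le> b / r * prob E"
      using E(2) \<open>b \<ge> 0\<close> \<open>r > 0\<close> by (intro mult_left_mono) auto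
    then show ?thesis
      using \<open>b \<ge> 0\<close> \<open>r > 0\<close> unfolding emeasure_eq_measure
      by (subst ennreal_mult[symmetric]) (auto intro: ennreal_leI)
  qed
  also have "\<dots> = (\<integral>\<^sup>+\<omega>. ennreal (b / r) * indicator E \<omega> \<partial>M)"
    using E by (simp add: nn_integral_cmult_indicator)
  also have "\<dots> \<le> risk M I \<Psi> J Y n f"
    unfolding risk_def by (intro nn_integral_mono) (auto simp: indicator_def loss)
  finally show ?thesis
    using fTheta by (intro bexI[of _ f]) (simp add: b_def r_def mult.assoc)
qed

section \<open>Choice of the level and comparison of the rates\<close>

lemma floor_level:
  fixes A Q \<kappa> :: real
  assumes "A > 0" "Q > 0" "\<kappa> > 0" "n \<ge> (1::nat)"
  defines "j \<equiv> \<lfloor>2 / \<kappa> * log 2 (Q * sqrt (real n) / A)\<rfloor>" and "B \<equiv> (Q / A) powr (2 / \<kappa>)"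
  shows "2 powr of_int j \<le> B * real n powr (1 / \<kappa>)" "B * real n powr (1 / \<kappa>) / 2 < 2 powr of_int j"
    "A / sqrt (real n) \<le> Q * 2 powr (- (of_int j / 2) * \<kappa>)"
proof -
  define x where "x = 2 / \<kappa> * log 2 (Q * sqrt (real n) / A)"
  have pos: "Q * sqrt (real n) / A > 0" using assms by simp
  have "2 powr x = (2 powr log 2 (Q * sqrt (real n) / A)) powr (2 / \<kappa>)"
    by (simp add: x_def powr_powr mult.commute)
  also have "\<dots> = ((Q / A) * sqrt (real n)) powr (2 / \<kappa>)"
    using pos by simp
  also have "\<dots> = B * (real n powr (1 / 2)) powr (2 / \<kappa>)"
    unfolding B_def powr_half_sqrt[OF of_nat_0_le_iff] by (rule powr_mult)
  also have "\<dots> = B * real n powr (1 / \<kappa>)"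
    by (simp add: powr_powr)
  finally have x: "2 powr x = B * real n powr (1 / \<kappa>)" .
  \<comment> \<open>At the real exponent \<open>x\<close> the admissible size Q 2^(- x \<kappa> / 2)
    equals A / sqrt n. Rounding down keeps the coefficients admissible and costs at most a factor 2
    in 2^j.\<close>
  have j: "of_int j \<le> x" "x < of_int j + 1"
    unfolding j_def x_def by linarith+
  show "2 powr of_int j \<le> B * real n powr (1 / \<kappa>)"
    unfolding x[symmetric] using j by simp
  have "2 powr x < 2 powr (of_int j + 1)" using j by simp
  then show "B * real n powr (1 / \<kappa>) / 2 < 2 powr of_int j"
    unfolding x by (simp add: powr_add)
  have "of_int j / 2 * \<kappa> \<le> x / 2 * \<kappa>"
    using j assms by (intro mult_right_mono) auto
  also have "\<dots> = log 2 (Q * sqrt (real n) / A)"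
    using assms by (simp add: x_def)
  finally have "2 powr (of_int j / 2 * \<kappa>) \<le> 2 powr log 2 (Q * sqrt (real n) / A)"
    by simp
  then have "2 powr (of_int j / 2 * \<kappa>) \<le> Q * sqrt (real n) / A"
    using pos by simp
  then show "A / sqrt (real n) \<le> Q * 2 powr (- (of_int j / 2) * \<kappa>)"
    using assms by (simp add: powr_minus field_simps)
qed

text \<open>For 2^j between B n^(1/\<kappa>) / 2 and B n^(1/\<kappa>), the divisors 2 and 4 give
  lower bounds at the levels j and j - 1. Since \<kappa> > 1, the level stays below
  \<open>J\<close>; and n^(1 / log log n), the threshold of \<open>J0\<close>, is eventually below
  every positive power of n.\<close>

lemma eventually_level_conditions:
  fixes c1 c2 B \<kappa> T :: real
  assumes "c1 > 0" "c2 > 0" "B > 0" "\<kappa> > 1"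
  shows "eventually (\<lambda>n::nat. c1 * (B * real n powr (1 / \<kappa>) / 2) \<ge> 256) sequentially"
    "eventually (\<lambda>n::nat. B * real n powr (1 / \<kappa>) / 2 > T) sequentially"
    "eventually (\<lambda>n::nat. c1 * (B * real n powr (1 / \<kappa>) / 4) > real n powr (1 / ln (ln (real n)))) sequentially"
    "eventually (\<lambda>n::nat. B * real n powr (1 / \<kappa>) \<le> c2 * real n) sequentially"
    "eventually (\<lambda>n::nat. 2 \<le> ln (real n) / (ln (ln (real n)))\<^sup>2) sequentially"
    "eventually (\<lambda>n::nat. ln (c1 * (B * real n powr (1 / \<kappa>) / 2)) \<ge> ln (real n) / (2 * \<kappa>)) sequentially"
proof -
  define a where "a = 1 / \<kappa>"
  have a: "a > 0" "a < 1" using assms by (auto simp: a_def)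
  define C where "C = c1 * B / 4"
  have C: "C > 0" using assms by (simp add: C_def)
  have "filterlim (\<lambda>n::nat. 2 * C * real n powr a) at_top sequentially"
    using a C by real_asymp
  then have "eventually (\<lambda>n::nat. 2 * C * real n powr a \<ge> 256) sequentially"
    unfolding filterlim_at_top by blast
  then show "eventually (\<lambda>n::nat. c1 * (B * real n powr (1 / \<kappa>) / 2) \<ge> 256) sequentially"
    by (simp add: C_def a_def field_simps)
  have "filterlim (\<lambda>n::nat. B * real n powr a / 2) at_top sequentially"
    using a assms by real_asymp
  then show "eventually (\<lambda>n::nat. B * real n powr (1 / \<kappa>) / 2 > T) sequentially"
    by (simp add: filterlim_at_top_dense a_def)
  have "eventually (\<lambda>n::nat. C * real n powr a > real n powr (1 / ln (ln (real n)))) sequentially"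
    using a C by real_asymp
  then show "eventually (\<lambda>n::nat. c1 * (B * real n powr (1 / \<kappa>) / 4) > real n powr (1 / ln (ln (real n)))) sequentially"
    by (simp add: C_def a_def mult.assoc)
  have "eventually (\<lambda>n::nat. B * real n powr a \<le> c2 * real n) sequentially"
    using a assms by real_asymp
  then show "eventually (\<lambda>n::nat. B * real n powr (1 / \<kappa>) \<le> c2 * real n) sequentially"
    by (simp add: a_def)
  show "eventually (\<lambda>n::nat. 2 \<le> ln (real n) / (ln (ln (real n)))\<^sup>2) sequentially"
    by real_asymp
  have "eventually (\<lambda>n::nat. ln (2 * C * real n powr a) \<ge> ln (real n) * (a / 2)) sequentially"
    using a C by real_asymp
  then show "eventually (\<lambda>n::nat. ln (c1 * (B * real n powr (1 / \<kappa>) / 2)) \<ge> ln (real n) / (2 * \<kappa>)) sequentially"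
    by (simp add: C_def a_def ac_simps)
qed

text \<open>The right-hand side is sqrt(2^j log n / n) at 2^j = n^(1 / (2 \<beta> + 1)). The powers
  of log n combine to 1 / 2 because \<beta> / (2 \<beta> + 1) + 1 / (4 \<beta> + 2) = 1 / 2.\<close>

lemma rate_eq:
  fixes \<beta> :: real
  assumes "\<beta> > 0" "real n > 1"
  shows "(real n / ln (real n)) powr (- \<beta> / (2 * \<beta> + 1)) * ln (real n) powr (1 / (4 * \<beta> + 2)) =
    sqrt (ln (real n)) * sqrt (real n powr (1 / (2 * \<beta> + 1))) / sqrt (real n)"
proof -
  have ln: "ln (real n) > 0" using assms by simp
  have four: "4 * \<beta> + 2 = 2 * (2 * \<beta> + 1)" by simp
  have e1: "\<beta> / (2 * \<beta> + 1) + 1 / (4 * \<beta> + 2) = 1 / 2"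
    unfolding four using assms by (simp add: divide_simps) (simp add: algebra_simps)
  have e2: "- \<beta> / (2 * \<beta> + 1) = 1 / (2 * \<beta> + 1) * (1 / 2) - 1 / 2"
    using assms by (simp add: divide_simps)
  have "(real n / ln (real n)) powr (- \<beta> / (2 * \<beta> + 1)) * ln (real n) powr (1 / (4 * \<beta> + 2)) =
      real n powr (- \<beta> / (2 * \<beta> + 1)) * (ln (real n) powr (\<beta> / (2 * \<beta> + 1)) * ln (real n) powr (1 / (4 * \<beta> + 2)))"
    using assms ln by (simp add: powr_divide powr_minus field_simps)
  also have "ln (real n) powr (\<beta> / (2 * \<beta> + 1)) * ln (real n) powr (1 / (4 * \<beta> + 2)) = sqrt (ln (real n))"
    using ln by (simp only: powr_add[symmetric] e1 powr_half_sqrt)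
  also have "real n powr (- \<beta> / (2 * \<beta> + 1)) = sqrt (real n powr (1 / (2 * \<beta> + 1))) / sqrt (real n)"
    unfolding e2 powr_diff using assms by (simp add: powr_half_sqrt[symmetric] powr_powr)
  finally show ?thesis by (simp add: mult.commute)
qed

text \<open>The constant collects the losses: 1 / (4 \<kappa>) because log |I_j| is only a fraction
  of log n, B / 2 from rounding the level, and sqrt R from the L1-norm of a wavelet.\<close>

lemma level_bound:
  fixes \<kappa> B R m p :: real
  assumes "\<kappa> > 0" "B > 0" "R > 0" "n \<ge> (1::nat)"
    and m: "ln m \<ge> ln (real n) / (2 * \<kappa>)" and p: "2 powr p > B * real n powr (1 / \<kappa>) / 2"
  shows "sqrt (1 / (4 * \<kappa>)) * sqrt (B / 2) / (8 * sqrt R) *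
      (sqrt (ln (real n)) * sqrt (real n powr (1 / \<kappa>)) / sqrt (real n))
    \<le> sqrt (ln m / 2) / (8 * sqrt (real n) * sqrt (R * 2 powr (- p)))"
proof -
  have "sqrt (1 / (4 * \<kappa>)) * sqrt (ln (real n)) = sqrt (ln (real n) / (2 * \<kappa>) / 2)"
    by (simp add: real_sqrt_mult[symmetric])
  also have "\<dots> \<le> sqrt (ln m / 2)"
    using m by (intro real_sqrt_le_mono divide_right_mono) auto
  finally have 1: "sqrt (1 / (4 * \<kappa>)) * sqrt (ln (real n)) \<le> sqrt (ln m / 2)" .
  have "sqrt (B / 2) * sqrt (real n powr (1 / \<kappa>)) = sqrt (B * real n powr (1 / \<kappa>) / 2)"
    by (simp add: real_sqrt_mult[symmetric])
  also have "\<dots> \<le> sqrt (2 powr p)"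
    using p by (intro real_sqrt_le_mono) simp
  finally have 2: "sqrt (B / 2) * sqrt (real n powr (1 / \<kappa>)) \<le> sqrt (2 powr p)" .
  have "(sqrt (1 / (4 * \<kappa>)) * sqrt (ln (real n))) * (sqrt (B / 2) * sqrt (real n powr (1 / \<kappa>)))
      \<le> sqrt (ln m / 2) * sqrt (2 powr p)"
    using assms by (intro mult_mono 1 2) (auto intro: order_trans[OF _ m])
  then have "(sqrt (1 / (4 * \<kappa>)) * sqrt (ln (real n))) * (sqrt (B / 2) * sqrt (real n powr (1 / \<kappa>))) / (8 * sqrt R * sqrt (real n))
      \<le> sqrt (ln m / 2) * sqrt (2 powr p) / (8 * sqrt R * sqrt (real n))"
    using assms by (intro divide_right_mono) auto
  also have "\<dots> = sqrt (ln m / 2) / (8 * sqrt (real n) * sqrt (R * 2 powr (- p)))"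
    unfolding powr_minus real_sqrt_mult real_sqrt_inverse using assms by (simp add: field_simps)
  finally show ?thesis by (simp add: mult.assoc mult.left_commute)
qed

theorem theorem4:
  fixes M :: "'w measure" and W :: "real \<Rightarrow> 'w \<Rightarrow> real"
    and s N :: nat and \<phi> \<psi> :: "real \<Rightarrow> real"
    and I :: "int \<Rightarrow> int set" and \<Psi> :: "int \<Rightarrow> int \<Rightarrow> real \<Rightarrow> real"
    and J :: "nat \<Rightarrow> int"
    and Y :: "nat \<Rightarrow> (real \<Rightarrow> real) \<Rightarrow> int \<Rightarrow> int \<Rightarrow> 'w \<Rightarrow> real"
    and \<beta> Q :: real
  assumes "wavelet_basis s N \<phi> \<psi> I \<Psi>"
    and "brownian_motion M W"
    and "\<And>n f j k. n \<ge> 1 \<Longrightarrow> f \<in> L2 (lebesgue_on {0..1}) \<Longrightarrow> j \<ge> -1 \<Longrightarrow> k \<in> I j \<Longrightarrow>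
           is_stochastic_integral M (observation W n f) (\<Psi> j k) (Y n f j k)"
    and "comparable_on {1..} (\<lambda>n. 2 powr of_int (J n)) real"
    and "\<beta> > 0" and "Q > 0"
  shows "(\<exists>c>0. \<exists>n0. \<forall>n\<ge>n0.
            (SUP f\<in>Theta I \<Psi> \<beta> Q. risk M I \<Psi> J Y n f)
              \<ge> ennreal (c * (real n / ln (real n)) powr (- \<beta> / (2 * \<beta> + 1))
                          * ln (real n) powr (1 / (4 * \<beta> + 2)))) \<and>
         \<not> (\<exists>C>0. \<exists>n0. \<forall>n\<ge>n0.
            (SUP f\<in>Theta I \<Psi> \<beta> Q. risk M I \<Psi> J Y n f)
              \<le> ennreal (C * (real n / ln (real n)) powr (- \<beta> / (2 * \<beta> + 1))))"
proof -
  define \<kappa> where "\<kappa> = 2 * \<beta> + 1"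
  define A where "A = 2 * Kconst 1 + 16"
  define B where "B = (Q / A) powr (2 / \<kappa>)"
  have \<kappa>: "\<kappa> > 1" and A: "A > 0" and B: "B > 0"
    using assms Kconst_1 by (auto simp: \<kappa>_def A_def B_def add_pos_pos)
  obtain R j1 where R: "R > 0" and j1: "j1 \<ge> 0" and supp: "\<And>j k. j \<ge> j1 \<Longrightarrow> k \<in> I j \<Longrightarrow>
      \<exists>c. \<forall>x\<in>{0..1}. x \<notin> {c..c + R * 2 powr (- of_int j)} \<longrightarrow> \<Psi> j k x = 0"
    using wavelet_basis_support[OF assms(1)] by blast
  have "comparable_on {-1..} (\<lambda>j. real (card (I j))) (\<lambda>j. 2 powr of_int j)"
    using assms(1) by (simp add: wavelet_basis_def)
  then obtain c1 where c1: "c1 > 0" and card: "\<And>j. j \<ge> -1 \<Longrightarrow> c1 * 2 powr of_int j \<le> real (card (I j))"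
    unfolding comparable_on_def by (metis atLeast_iff)
  obtain c2 where c2: "c2 > 0" and Jn: "\<And>n. n \<ge> 1 \<Longrightarrow> c2 * real n \<le> 2 powr of_int (J n)"
    using assms(4) unfolding comparable_on_def by (metis atLeast_iff)
  define c where "c = sqrt (1 / (4 * \<kappa>)) * sqrt (B / 2) / (8 * sqrt R)"
  have "c > 0" using \<kappa> B R by (simp add: c_def)
  define S where "S = (\<lambda>n. SUP f\<in>Theta I \<Psi> \<beta> Q. risk M I \<Psi> J Y n f)"
  define a where "a = (\<lambda>n::nat. (real n / ln (real n)) powr (- \<beta> / (2 * \<beta> + 1)))"
  define g where "g = (\<lambda>n::nat. ln (real n) powr (1 / (4 * \<beta> + 2)))"
  have lower: "eventually (\<lambda>n. S n \<ge> ennreal (c * a n * g n)) sequentially"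
    using eventually_level_conditions(1)[OF c1 c2 B \<kappa>]
      eventually_level_conditions(2)[OF c1 c2 B \<kappa>, of "2 powr of_int j1"]
      eventually_level_conditions(3-6)[OF c1 c2 B \<kappa>] eventually_ge_at_top[of 2]
  proof eventually_elim
    case (elim n)
    have n: "n \<ge> 1" using elim by simp
    define j where "j = \<lfloor>2 / \<kappa> * log 2 (Q * sqrt (real n) / A)\<rfloor>"
    have "\<kappa> > 0" using \<kappa> by simp
    note lev = floor_level[OF A assms(6) \<open>\<kappa> > 0\<close> n, folded j_def B_def]
    have "2 powr of_int j1 < 2 powr real_of_int j"
      using elim(2) lev(2) by linarith
    then have "j1 < j" by simp
    then have j: "j \<ge> -1" "j - 1 \<ge> -1" using j1 by auto
    have "c1 * (B * real n powr (1 / \<kappa>) / 2) \<le> c1 * 2 powr of_int j"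
      using lev(2) c1 by (intro mult_left_mono) auto
    also have "\<dots> \<le> card (I j)" by (rule card[OF j(1)])
    finally have cardj: "c1 * (B * real n powr (1 / \<kappa>) / 2) \<le> card (I j)" .
    \<comment> \<open>The threshold is passed already at level \<open>j - 1\<close>, so
      \<open>J0\<close> lies strictly below \<open>j\<close> and level \<open>j\<close> belongs to
      the data-driven part of \<open>fhat1\<close>.\<close>
    have "real n powr (1 / ln (ln (real n))) < c1 * (B * real n powr (1 / \<kappa>) / 4)"
      by (rule elim)
    also have "\<dots> \<le> c1 * 2 powr of_int (j - 1)"
      using lev(2) c1 by (intro mult_left_mono) (auto simp: powr_diff)
    also have "\<dots> \<le> card (I (j - 1))" by (rule card[OF j(2)])
    finally have "real n powr (1 / ln (ln (real n))) < card (I (j - 1))" .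
    note J0 = J0_le[where I = I and j = "j - 1", OF j(2) this]
    have "2 powr of_int j \<le> 2 powr real_of_int (J n)"
      using lev(1) elim(4) Jn[OF n] by linarith
    then have "j \<le> J n" by simp
    have "1 \<in> Pset n"
      unfolding Pset_def using elim(5) by (auto intro: exI[of _ 0])
    have "real (card (I j)) \<ge> 256" using elim(1) cardj by linarith
    then have card256: "card (I j) \<ge> 256" by linarith
    have "ln (c1 * (B * real n powr (1 / \<kappa>) / 2)) \<le> ln (card (I j))"
      using cardj c1 B n by (intro ln_mono) auto
    then have lncard: "ln (real n) / (2 * \<kappa>) \<le> ln (card (I j))"
      using elim(6) by linarith
    obtain f where f: "f \<in> Theta I \<Psi> \<beta> Q"
      "risk M I \<Psi> J Y n f \<ge> ennreal (sqrt (ln (card (I j)) / 2) / (8 * sqrt (real n) * sqrt (R * 2 powr (- of_int j))))"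
    proof -
      have "J0 I n < j" "j1 \<le> j" using J0(2) \<open>j1 < j\<close> by auto
      have "(2 * Kconst 1 + 16) / sqrt (real n) \<le> Q * 2 powr (- (of_int j / 2) * (2 * \<beta> + 1))"
        using lev(3) unfolding A_def \<kappa>_def .
      then have "\<exists>f\<in>Theta I \<Psi> \<beta> Q. risk M I \<Psi> J Y n f \<ge>
          ennreal (sqrt (ln (card (I j)) / 2) / (8 * sqrt (real n) * sqrt (R * 2 powr (- of_int j))))"
        using n j(1) \<open>j1 \<le> j\<close>
        by (intro risk_lower_bound_at_level[OF assms(1,2)] assms(3,6) \<open>1 \<in> Pset n\<close> J0(1) \<open>J0 I n < j\<close>
            \<open>j \<le> J n\<close> card256 R supp)
      then show thesis using that by blast
    qed
    have "c * a n * g n = c * (sqrt (ln (real n)) * sqrt (real n powr (1 / \<kappa>)) / sqrt (real n))"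
      using rate_eq[OF assms(5), of n] elim(7) by (simp only: a_def g_def \<kappa>_def mult.assoc)
    also have "\<dots> \<le> sqrt (ln (card (I j)) / 2) / (8 * sqrt (real n) * sqrt (R * 2 powr (- of_int j)))"
      unfolding c_def by (rule level_bound[OF \<open>\<kappa> > 0\<close> B R n lncard lev(2)])
    finally have "ennreal (c * a n * g n) \<le> risk M I \<Psi> J Y n f"
      using f(2) by (meson ennreal_leI order_trans)
    also have "\<dots> \<le> S n"
      unfolding S_def using f(1) by (rule SUP_upper)
    finally show ?case .
  qed
  \<comment> \<open>The lower bound exceeds the adaptive rate \<open>a\<close> by the factor
    \<open>c * g n\<close>, which tends to infinity and so outgrows any constant
    \<open>C\<close>.\<close>
  have "\<not> eventually (\<lambda>n. S n \<le> ennreal (C * a n)) sequentially" if "C > 0" for C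
  proof
    assume "eventually (\<lambda>n. S n \<le> ennreal (C * a n)) sequentially"
    moreover have "filterlim (\<lambda>n::nat. c * g n) at_top sequentially"
      unfolding g_def using \<open>c > 0\<close> assms(5) by real_asymp
    then have "eventually (\<lambda>n. c * g n > C) sequentially"
      by (simp add: filterlim_at_top_dense)
    ultimately have "eventually (\<lambda>n::nat. False) sequentially"
      using lower eventually_ge_at_top[of 2]
    proof eventually_elim
      case (elim n)
      \<comment> \<open>This uses n \<ge> 2: at n = 1 the quotient n / ln n is 0 by the division
        convention, and then \<open>a n\<close> is 0 too.\<close>
      have "a n > 0" using elim by (simp add: a_def)
      have "ennreal (c * a n * g n) \<le> ennreal (C * a n)"
        using elim by order
      then have "c * g n * a n \<le> C * a n"
        using \<open>C > 0\<close> \<open>a n > 0\<close> by (simp add: mult.commute mult.left_commute)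
      then show False
        using elim \<open>a n > 0\<close> by simp
    qed
    then show False by simp
  qed
  then show ?thesis
    using lower \<open>c > 0\<close> unfolding S_def a_def g_def eventually_sequentially by blast
qed

end
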